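(* Let $\kappa\in(0,1]$, $\alpha>3$ and $\gamma\ge0$ with $\alpha-\gamma>3$. There exist $\overline W_0=\overline W_0(\kappa,\alpha,\gamma)>0$ and $c_3=c_3(\kappa,\alpha,\gamma)>0$ such that for all $\overline W\ge\overline W_0$ the following holds for the inhomogeneous one-dimensional model on $[N]=\{1,\dots,N\}$, $N\in\mathbb N$, with nearest-neighbor weights $W_{\{i-1,i\}}\ge\overline W i^\alpha$, $2\le i\le N$, and with pinning of type P1 or P2 (see context). Let $E',E''$ be disjoint subsets of $\{\{x,y\}\subseteq[N]:x\ne y\}$. For an edge $e$ write $e=\{x_e,y_e\}$ with $x_e<y_e$. Assume that every $e\in E'$ is a nearest-neighbor edge, $y_e-x_e=1$, and that for any two different $e,\tilde e\in E'\cup E''$ the open intervals $(x_e,y_e)$ and $(x_{\tilde e},y_{\tilde e})$ are disjoint. Set $m_x:=c_3\overline W x^\gamma$ for $x\in\mathbb N$. Then for all exponents $m_e$ with $0\le m_e<W_e$ for $e\in E'$ and $0\le m_e\le m_{x_e}$ for $e\in E''$, $$\mathbb E^{[N]}_{W,h}\Big[\prod_{e\in E'}B_e^{m_e}\cdot\prod_{e\in E''}B_e^{m_e}\Big]\le\prod_{e\in E'}\frac1{1-\frac{m_e}{W_e}}\cdot(1+\kappa)^{|E''|}\le(1+\kappa)^{|E'|+|E''|},$$ uniformly in $N$. In particular, for all $e=\{x,y\}$ with $x,y\in[N]$, $x<y$, and all $m\in[0,m_x]$, $$\mathbb E^{[N]}_{W,h}\big[(\cosh(u_x-u_y))^m\big]\le\mathbb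 E^{[N]}_{W,h}[B_e^m]\le1+\kappa .$$ In the case P1 of pinning, all estimates are also uniform in the pinning $h$. The same results hold if arbitrarily many additional non-nearest-neighbor edges $e$ with arbitrary weights $W_e\ge0$ are added to the nearest-neighbor graph on $[N]$.
   Context: General model. Let $\Lambda$ be a finite non-empty set, $\rho\notin\Lambda$ (the pinning vertex), and let $E$ be the set of all two-element subsets of $\Lambda\cup\{\rho\}$. Let $W_e\ge0$, $e\in E$, be weights ($W_{ij}:=W_{\{i,j\}}$); $h_i:=W_{i\rho}$, $i\in\Lambda$, are the pinning strengths. Let $E_+=\{e\in E:W_e>0\}$ and assume $(\Lambda\cup\{\rho\},E_+)$ is connected. For $(u,s)\in\mathbb R^\Lambda\times\mathbb R^\Lambda$ set $u_\rho=s_\rho=0$ and, for $e=\{i,j\}\in E$, $$B_e=B_{ij}=\cosh(u_i-u_j)+\tfrac12(s_i-s_j)^2e^{u_i+u_j}.$$ Let $D=(D_{ij})_{i,j\in\Lambda}$ with $D_{ij}=-W_{ij}e^{u_i+u_j}$ for $i\ne j$ and $D_{ii}=\sum_{k\in(\Lambda\cup\{\rho\})\setminus\{i\}}W_{ik}e^{u_i+u_k}$. Then $$\mu(du\,ds)=e^{-\sum_{e\in E_+}W_e(B_e-1)}\det D\prod_{i\in\Lambda}\frac{e^{-u_i}}{2\pi}\,du_i\,ds_i$$ is a probability measure on $\mathbb R^\Lambda\times\mathbb R^\Lambda$ (known fact). Expectation with respect to it is written $\mathbb E^{\Lambda}_{W,h}$ or $\mathbb E^{\Lambda\cup\{\rho\}}_{W,h}$.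 Inhomogeneous one-dimensional model. The vertices are $[N]=\{1,\dots,N\}$; nearest-neighbor edges $\{i-1,i\}$, $2\le i\le N$, carry weights $W_{\{i-1,i\}}\ge\overline Wi^\alpha$; all other edges inside $[N]$ have weight $0$ (unless additional edges are explicitly added). Two versions of pinning are allowed: P1: $\rho\notin[N]$, $\Lambda=[N]$, with any pinning vector $h\in[0,\infty)^N\setminus\{0\}$, $W_{j\rho}=h_j$. P2: $\rho$ is one of the vertices of $[N]$ (e.g. $\rho=N$), $\Lambda=[N]\setminus\{\rho\}$, and $h_j=W_{j\rho}$ for $j\in[N]\setminus\{\rho\}$. In both cases expectation is denoted $\mathbb E^{[N]}_{W,h}$.
   Formalization: The second inequality of the chain, false for m_e near W_e (E'={e}, m_e=0.9W_e gives 10 > 1+κ), is stated only when each e in E' has m_e ≤ m_{x_e} or m_e ≤ κ/(1+κ)·W_e; the first inequality holds on the full range 0 ≤ m_e < W_e. *)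

theory Defs
  imports "HOL-Probability.Probability" "HOL-Combinatorics.Combinatorics"
begin

definition edges :: "'a set \<Rightarrow> 'a set set" where
  "edges V = {e. e \<subseteq> V \<and> card e = 2}"

text \<open>Fields are functions on \<open>\<Lambda>\<close>; \<open>pin \<rho>\<close> extends them to \<open>\<Lambda> \<union> {\<rho>}\<close> by the value 0 at \<open>\<rho>\<close>.\<close>
definition pin :: "'a \<Rightarrow> ('a \<Rightarrow> real) \<Rightarrow> 'a \<Rightarrow> real" where
  "pin \<rho> u = u(\<rho> := 0)"

definition B_pair :: "'a \<Rightarrow> ('a \<Rightarrow> real) \<Rightarrow> ('a \<Rightarrow> real) \<Rightarrow> 'a \<Rightarrow> 'a \<Rightarrow> real" where
  "B_pair \<rho> u s i j =
     cosh (pin \<rho> u i - pin \<rho> u j)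
     + 1 / 2 * (pin \<rho> s i - pin \<rho> s j)\<^sup>2 * exp (pin \<rho> u i + pin \<rho> u j)"

text \<open>An edge is the set of its endpoints, which a linear order on the vertices recovers as
  \<open>Min e < Max e\<close>. By symmetry of \<open>B_pair\<close> the order is immaterial (see \<open>B_edge_doubleton\<close>).\<close>
definition B_edge :: "'a::linorder \<Rightarrow> ('a \<Rightarrow> real) \<Rightarrow> ('a \<Rightarrow> real) \<Rightarrow> 'a set \<Rightarrow> real" where
  "B_edge \<rho> u s e = B_pair \<rho> u s (Min e) (Max e)"

lemma B_pair_commute: "B_pair \<rho> u s i j = B_pair \<rho> u s j i"
proof -
  have "cosh (pin \<rho> u i - pin \<rho> u j) = cosh (pin \<rho> u j - pin \<rho> u i)"
    by (metis cosh_minus minus_diff_eq)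
  then show ?thesis
    by (simp add: B_pair_def power2_commute[of "pin \<rho> s i"] add.commute[of "pin \<rho> u i"])
qed

lemma B_edge_doubleton: "B_edge \<rho> u s {i, j} = B_pair \<rho> u s i j"
  by (cases "i \<le> j") (auto simp: B_edge_def B_pair_commute min_def max_def)

definition D_mat :: "'a set \<Rightarrow> 'a \<Rightarrow> ('a set \<Rightarrow> real) \<Rightarrow> ('a \<Rightarrow> real) \<Rightarrow> 'a \<Rightarrow> 'a \<Rightarrow> real" where
  "D_mat \<Lambda> \<rho> W u i j =
     (if i = j then \<Sum>k\<in>insert \<rho> \<Lambda> - {i}. W {i, k} * exp (pin \<rho> u i + pin \<rho> u k)
      else - W {i, j} * exp (pin \<rho> u i + pin \<rho> u j))"

text \<open>Determinant of a matrix whose rows and columns are indexed by a finite set.\<close>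
definition set_det :: "'a set \<Rightarrow> ('a \<Rightarrow> 'a \<Rightarrow> real) \<Rightarrow> real" where
  "set_det I A = (\<Sum>p | p permutes I. of_int (sign p) * (\<Prod>i\<in>I. A i (p i)))"

lemma set_det_UNIV: "set_det UNIV (\<lambda>i j. A $ i $ j) = det A"
  by (simp add: set_det_def det_def)

definition mu_density ::
    "'a::linorder set \<Rightarrow> 'a \<Rightarrow> ('a set \<Rightarrow> real) \<Rightarrow> ('a \<Rightarrow> real) \<Rightarrow> ('a \<Rightarrow> real) \<Rightarrow> real" where
  "mu_density \<Lambda> \<rho> W u s =
     exp (- (\<Sum>e | e \<in> edges (insert \<rho> \<Lambda>) \<and> W e > 0. W e * (B_edge \<rho> u s e - 1)))
     * set_det \<Lambda> (D_mat \<Lambda> \<rho> W u)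
     * (\<Prod>i\<in>\<Lambda>. exp (- u i) / (2 * pi))"

text \<open>The pinning strengths are part of the weight function: \<open>h i = W {i, \<rho>}\<close>.\<close>
definition mu ::
    "'a::linorder set \<Rightarrow> 'a \<Rightarrow> ('a set \<Rightarrow> real) \<Rightarrow> (('a \<Rightarrow> real) \<times> ('a \<Rightarrow> real)) measure" where
  "mu \<Lambda> \<rho> W =
     density (PiM \<Lambda> (\<lambda>_. lborel) \<Otimes>\<^sub>M PiM \<Lambda> (\<lambda>_. lborel))
       (\<lambda>(u, s). ennreal (mu_density \<Lambda> \<rho> W u s))"

text \<open>Only nonnegative observables occur. Their expectation is taken in \<open>[0, \<infinity>]\<close>, so an upper bound
  on it includes integrability.\<close>
definition expect ::
    "'a::linorder set \<Rightarrow> 'a \<Rightarrow> ('a set \<Rightarrow> real) \<Rightarrow> (('a \<Rightarrow> real) \<Rightarrow> ('a \<Rightarrow> real) \<Rightarrow> real) \<Rightarrow> ennreal" where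
  "expect \<Lambda> \<rho> W f = (\<integral>\<^sup>+ (u, s). ennreal (f u s) \<partial>mu \<Lambda> \<rho> W)"

definition pinning_P1 :: "nat \<Rightarrow> nat \<Rightarrow> (nat set \<Rightarrow> real) \<Rightarrow> bool" where
  "pinning_P1 N \<rho> W \<longleftrightarrow>
     \<rho> \<notin> {1..N} \<and> (\<forall>j\<in>{1..N}. W {j, \<rho>} \<ge> 0) \<and> (\<exists>j\<in>{1..N}. W {j, \<rho>} \<noteq> 0)"

text \<open>\<open>N \<ge> 2\<close> says that \<open>\<Lambda> = {1..N} - {\<rho>}\<close> is non-empty.\<close>
definition pinning_P2 :: "nat \<Rightarrow> nat \<Rightarrow> bool" where
  "pinning_P2 N \<rho> \<longleftrightarrow> \<rho> \<in> {1..N} \<and> N \<ge> 2"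

text \<open>Edges of \<open>{1..N}\<close> that are not nearest-neighbor edges carry arbitrary nonnegative weights; the
  pure nearest-neighbor model is the case where all these weights are 0.\<close>
definition inhom_model :: "real \<Rightarrow> real \<Rightarrow> nat \<Rightarrow> nat \<Rightarrow> (nat set \<Rightarrow> real) \<Rightarrow> bool" where
  "inhom_model \<alpha> Wbar N \<rho> W \<longleftrightarrow>
     (\<forall>e\<in>edges {1..N}. W e \<ge> 0)
     \<and> (\<forall>i\<in>{2..N}. W {i - 1, i} \<ge> Wbar * real i powr \<alpha>)
     \<and> (pinning_P1 N \<rho> W \<or> pinning_P2 N \<rho>)"

text \<open>Under P1 the removal of \<open>\<rho>\<close> has no effect, under P2 it gives \<open>\<Lambda> = {1..N} - {\<rho>}\<close>.\<close>
definition inhom_expect ::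
    "nat \<Rightarrow> nat \<Rightarrow> (nat set \<Rightarrow> real) \<Rightarrow> ((nat \<Rightarrow> real) \<Rightarrow> (nat \<Rightarrow> real) \<Rightarrow> real) \<Rightarrow> ennreal" where
  "inhom_expect N \<rho> W f = expect ({1..N} - {\<rho>}) \<rho> W f"

text \<open>The open interval \<open>(x\<^sub>e, y\<^sub>e)\<close> is an interval of real numbers: over the integers the interval of
  a nearest-neighbor edge would be empty, and its disjointness from others would say nothing.\<close>
definition edge_interval :: "nat set \<Rightarrow> real set" where
  "edge_interval e = {real (Min e) <..< real (Max e)}"

definition max_exponent :: "real \<Rightarrow> real \<Rightarrow> real \<Rightarrow> nat \<Rightarrow> real" where
  "max_exponent \<gamma> c3 Wbar x = c3 * Wbar * real x powr \<gamma>"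

end

theory Submission
  imports Defs
begin

text \<open>Eliminating a vertex \<open>n\<close> maps the model to itself. Put \<open>y = (\<Sum>j. W\<^sub>n\<^sub>j * exp (u\<^sub>j - u\<^sub>n))\<close> and
  \<open>S = (\<Sum>j. W\<^sub>n\<^sub>j)\<close>. For fixed \<open>y\<close>, completing the square in \<open>s\<^sub>n\<close> and taking a Schur complement turns the
  density into that of the remaining vertices with the star-mesh weights \<open>W\<^sub>i\<^sub>j + W\<^sub>n\<^sub>i * W\<^sub>n\<^sub>j / y\<close>, times a
  Gaussian in \<open>s\<^sub>n\<close> and the factor \<open>exp (- (y - S)\<^sup>2 / (2 * y)) / sqrt (2 * pi * y)\<close>, which has
  integral 1. By induction the total mass is at most 1 for all nonnegative weights.

  The determinant is affine in each weight with nonnegative coefficients, so lowering the weights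
  \<open>W\<^sub>e\<close> to \<open>W\<^sub>e - \<lambda>\<^sub>e\<close> costs at most the factor \<open>1 / (1 - \<lambda>\<^sub>e / W\<^sub>e)\<close> per edge. Hence
  \<open>exp (\<Sum>e. \<lambda>\<^sub>e * (B\<^sub>e - 1))\<close> has expectation at most \<open>\<Prod>e. 1 / (1 - \<lambda>\<^sub>e / W\<^sub>e)\<close>.

  Finally, \<open>B\<close> is the hyperbolic cosine of a hyperbolic distance, so \<open>B\<^sub>x\<^sub>y\<close> is controlled by the
  nearest-neighbor distances \<open>d\<^sub>i\<close> between \<open>x\<close> and \<open>y\<close>. From \<open>ln (cosh d) \<le> d\<^sup>2 / 2\<close>, the Cauchy-Schwarz
  inequality with weights proportional to \<open>i powr (- 3 / 2)\<close>, and \<open>d\<^sub>i\<^sup>2 / 2 \<le> cosh d\<^sub>i - 1\<close>, a power of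
  \<open>B\<^sub>x\<^sub>y\<close> is bounded pointwise by such an exponential, with ratios \<open>\<lambda>\<^sub>i / W\<^sub>i\<close> summable because
  \<open>\<alpha> - \<gamma> > 3\<close>.\<close>

section \<open>Determinants over finite index sets\<close>

lemma set_det_cong:
  assumes "\<And>i j. i \<in> I \<Longrightarrow> j \<in> I \<Longrightarrow> A i j = B i j"
  shows "set_det I A = set_det I B"
  unfolding set_det_def
proof (rule sum.cong, goal_cases)
  case (2 p)
  then have "(\<Prod>i\<in>I. A i (p i)) = (\<Prod>i\<in>I. B i (p i))"
    by (intro prod.cong refl assms) (auto simp: permutes_in_image)
  then show ?case by simp
qed simp

lemma set_det_empty [simp]: "set_det {} A = 1"
  by (simp add: set_det_def)

lemma set_det_row_linear:
  assumes "finite I" "i \<in> I"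
  shows "set_det I (A(i := \<lambda>k. v k + c * w k)) = set_det I (A(i := v)) + c * set_det I (A(i := w))"
proof -
  have "(\<Prod>k\<in>I. (A(i := x)) k (p k)) = x (p i) * (\<Prod>k\<in>I - {i}. A k (p k))" for x p
    using assms by (subst prod.remove[of _ i]) (auto intro!: prod.cong)
  then show ?thesis
    unfolding set_det_def by (simp add: algebra_simps sum.distrib sum_distrib_left)
qed

lemma set_det_zero_row:
  assumes "finite I" "i \<in> I" "\<And>j. j \<in> I \<Longrightarrow> A i j = 0"
  shows "set_det I A = 0"
  unfolding set_det_def
proof (rule sum.neutral, safe)
  fix p assume "p permutes I"
  then have "A i (p i) = 0" using assms by (simp add: permutes_in_image)
  then have "(\<Prod>i\<in>I. A i (p i)) = 0" using assms by (intro prod_zero) auto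
  then show "of_int (sign p) * (\<Prod>i\<in>I. A i (p i)) = 0" by simp
qed

text \<open>Composing every permutation with the transposition of \<open>i\<close> and
  \<open>j\<close> flips its sign but, as the two rows agree, leaves its product unchanged.
  Reindexing the sum therefore gives \<open>set_det I A = - set_det I A\<close>.\<close>

lemma set_det_equal_rows:
  assumes I: "finite I" "i \<in> I" "j \<in> I" "i \<noteq> j" and eq: "A i = A j"
  shows "set_det I A = 0"
proof -
  let ?t = "Transposition.transpose i j"
  have t: "?t permutes I" using I by (simp add: permutes_swap_id)
  have "set_det I A = (\<Sum>p | p permutes I. of_int (sign (p \<circ> ?t)) * (\<Prod>k\<in>I. A k ((p \<circ> ?t) k)))"
    unfolding set_det_def by (rule sum_permutations_compose_right[OF t])
  also have "\<dots> = (\<Sum>p | p permutes I. - (of_int (sign p) * (\<Prod>k\<in>I. A k (p k))))"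
  proof (rule sum.cong, goal_cases)
    case (2 p)
    then have p: "p permutes I" by simp
    have "sign (p \<circ> ?t) = - sign p"
      using p t I by (simp add: sign_compose permutes_imp_permutation sign_swap_id)
    moreover have "(\<Prod>k\<in>I. A k ((p \<circ> ?t) k)) = (\<Prod>k\<in>I. A k (p k))"
    proof -
      have "A (?t k) = A k" for k
        using eq by (cases "k = i"; cases "k = j") auto
      then have "(\<Prod>k\<in>I. A k (p k)) = (\<Prod>k\<in>I. A (?t k) (p k))" by simp
      also have "\<dots> = (\<Prod>k\<in>I. A (?t (?t k)) (p (?t k)))"
        by (rule prod.permute[OF t, unfolded comp_def])
      finally show ?thesis by simp
    qed
    ultimately show ?case by simp
  qed simp
  also have "\<dots> = - set_det I A" unfolding set_det_def by (rule sum_negf)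
  finally show ?thesis by simp
qed

lemma set_det_add_row:
  assumes "finite I" "i \<in> I" "j \<in> I" "i \<noteq> j"
  shows "set_det I (A(i := \<lambda>k. A i k + c * A j k)) = set_det I A"
proof -
  have "set_det I (A(i := A j)) = 0"
    using assms by (intro set_det_equal_rows[of _ i j]) auto
  then show ?thesis
    using assms set_det_row_linear[of I i A "A i" c "A j"] by simp
qed

text \<open>A permutation of \<open>insert n I\<close> that moves \<open>n\<close> sends some
  \<open>i\<close> in \<open>I\<close> to \<open>n\<close>, so its product contains the zero entry
  \<open>A i n\<close>. Only the permutations fixing \<open>n\<close>, which are those of
  \<open>I\<close>, survive.\<close>

lemma set_det_insert_zero_column:
  assumes I: "finite I" "n \<notin> I" and z: "\<And>i. i \<in> I \<Longrightarrow> A i n = 0"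
  shows "set_det (insert n I) A = A n n * set_det I A"
proof -
  have fin: "finite {p. p permutes insert n I}" using I by (simp add: finite_permutations)
  have "set_det (insert n I) A = (\<Sum>p | p permutes I. of_int (sign p) * (\<Prod>i\<in>insert n I. A i (p i)))"
    unfolding set_det_def
  proof (rule sum.mono_neutral_right[OF fin])
    show "{p. p permutes I} \<subseteq> {p. p permutes insert n I}"
      by (auto intro: permutes_subset)
    show "\<forall>p\<in>{p. p permutes insert n I} - {p. p permutes I}.
            of_int (sign p) * (\<Prod>i\<in>insert n I. A i (p i)) = 0"
    proof
      fix p assume "p \<in> {p. p permutes insert n I} - {p. p permutes I}"
      then have p: "p permutes insert n I" "\<not> p permutes I" by simp_all
      have "p n \<noteq> n"
      proof
        assume "p n = n"
        then have "\<And>x. x \<notin> I \<Longrightarrow> p x = x"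
          using p by (metis insertE permutes_not_in)
        then show False using p permutes_superset[of p "insert n I" I] by auto
      qed
      obtain i where i: "p i = n" using p by (metis permutes_surj surjE)
      have "i \<noteq> n" using i \<open>p n \<noteq> n\<close> by auto
      moreover have "i \<in> insert n I" using i permutes_not_in[OF p(1), of i] \<open>i \<noteq> n\<close> by metis
      ultimately have "i \<in> I" by simp
      then have "A i (p i) = 0" using z i by simp
      then have "(\<Prod>i\<in>insert n I. A i (p i)) = 0"
        using I \<open>i \<in> I\<close> by (intro prod_zero) auto
      then show "of_int (sign p) * (\<Prod>i\<in>insert n I. A i (p i)) = 0" by simp
    qed
  qed
  also have "\<dots> = (\<Sum>p | p permutes I. A n n * (of_int (sign p) * (\<Prod>i\<in>I. A i (p i))))"
    using I by (intro sum.cong refl) (simp add: permutes_not_in)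
  finally show ?thesis by (simp add: set_det_def sum_distrib_left)
qed

text \<open>Subtracting \<open>A i n / A n n\<close> times row \<open>n\<close> from every other row
  \<open>i\<close> clears column \<open>n\<close> without changing the determinant.\<close>

lemma set_det_Schur:
  assumes I: "finite I" "n \<notin> I" and nz: "A n n \<noteq> 0"
  shows "set_det (insert n I) A = A n n * set_det I (\<lambda>i j. A i j - A i n * A n j / A n n)"
proof -
  let ?B = "\<lambda>i j. A i j - A i n * A n j / A n n"
  \<comment> \<open>\<open>J\<close> is the set of rows already cleared. Row \<open>n\<close> is
    never altered, so each new row operation can still use it.\<close>
  have "set_det (insert n I) (\<lambda>i. if i \<in> J then ?B i else A i) = set_det (insert n I) A"
    if "finite J" "J \<subseteq> I" for J
    using that
  proof (induction J rule: finite_induct)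
    case (insert x J)
    let ?A = "\<lambda>i. if i \<in> J then ?B i else A i"
    have "(\<lambda>i. if i \<in> insert x J then ?B i else A i)
        = ?A(x := \<lambda>k. ?A x k + (- A x n / A n n) * ?A n k)"
      using insert I by (auto simp: fun_eq_iff)
    moreover have "set_det (insert n I) \<dots> = set_det (insert n I) ?A"
      by (rule set_det_add_row) (use insert I in auto)
    ultimately show ?case
      using insert by simp
  qed simp
  from this[of I] I have "set_det (insert n I) A = set_det (insert n I) (\<lambda>i. if i \<in> I then ?B i else A i)"
    by simp
  also have "\<dots> = A n n * set_det I (\<lambda>i. if i \<in> I then ?B i else A i)"
    using I nz by (subst set_det_insert_zero_column) auto
  also have "set_det I (\<lambda>i. if i \<in> I then ?B i else A i) = set_det I ?B"
    by (rule set_det_cong) simp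
  finally show ?thesis .
qed

section \<open>Determinants of weighted Laplacians\<close>

text \<open>The Laplacian of the graph with conductances \<open>c\<close>, with the row and column
  of \<open>\<rho>\<close> deleted. By the matrix-tree theorem its determinant is the weighted
  number of spanning trees, which is why it is affine in each conductance with nonnegative
  coefficients.\<close>

definition lap :: "'a set \<Rightarrow> 'a \<Rightarrow> ('a set \<Rightarrow> real) \<Rightarrow> 'a \<Rightarrow> 'a \<Rightarrow> real" where
  "lap \<Lambda> \<rho> c i j = (if i = j then \<Sum>k\<in>insert \<rho> \<Lambda> - {i}. c {i, k} else - c {i, j})"

text \<open>The conductances left on the other vertices when the vertex \<open>n\<close> with total conductance \<open>C\<close> is
  eliminated.\<close>
definition star_mesh :: "'a \<Rightarrow> ('a set \<Rightarrow> real) \<Rightarrow> real \<Rightarrow> 'a set \<Rightarrow> real" where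
  "star_mesh n c C e = c e + (\<Prod>i\<in>e. c {n, i}) / C"

lemma star_mesh_doubleton:
  "i \<noteq> j \<Longrightarrow> star_mesh n c C {i, j} = c {i, j} + c {n, i} * c {n, j} / C"
  by (simp add: star_mesh_def)

lemma set_det_lap_cong:
  assumes "\<And>i j. i \<in> \<Lambda> \<Longrightarrow> j \<in> insert \<rho> \<Lambda> \<Longrightarrow> i \<noteq> j \<Longrightarrow> c {i, j} = c' {i, j}"
  shows "set_det \<Lambda> (lap \<Lambda> \<rho> c) = set_det \<Lambda> (lap \<Lambda> \<rho> c')"
  by (rule set_det_cong) (use assms in \<open>auto simp: lap_def intro!: sum.cong\<close>)

text \<open>The Schur complement of a Laplacian is again a Laplacian: off the diagonal, the
  correction \<open>c {n, i} * c {n, j} / C\<close> is the conductance added by star-mesh, and the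
  diagonal stays consistent because the conductances at \<open>n\<close> add up to
  \<open>C\<close>.\<close>

lemma set_det_lap_insert:
  assumes fin: "finite \<Lambda>" and n: "n \<notin> insert \<rho> \<Lambda>"
    and C: "C = (\<Sum>k\<in>insert \<rho> \<Lambda>. c {n, k})" "C \<noteq> 0"
  shows "set_det (insert n \<Lambda>) (lap (insert n \<Lambda>) \<rho> c)
       = C * set_det \<Lambda> (lap \<Lambda> \<rho> (star_mesh n c C))"
proof -
  let ?L = "lap (insert n \<Lambda>) \<rho> c"
  have nn: "?L n n = C"
    unfolding lap_def C using n by (auto intro!: sum.cong)
  have "set_det (insert n \<Lambda>) ?L = ?L n n * set_det \<Lambda> (\<lambda>i j. ?L i j - ?L i n * ?L n j / ?L n n)"
    by (rule set_det_Schur) (use n fin C nn in auto)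
  also have "set_det \<Lambda> (\<lambda>i j. ?L i j - ?L i n * ?L n j / ?L n n)
      = set_det \<Lambda> (lap \<Lambda> \<rho> (star_mesh n c C))"
  proof (rule set_det_cong)
    fix i j assume ij: "i \<in> \<Lambda>" "j \<in> \<Lambda>"
    then have ni: "n \<noteq> i" "n \<noteq> j" using n by auto
    have sw: "c {i, n} = c {n, i}" by (simp add: insert_commute)
    show "?L i j - ?L i n * ?L n j / ?L n n = lap \<Lambda> \<rho> (star_mesh n c C) i j"
    proof (cases "i = j")
      case True
      have 1: "insert \<rho> (insert n \<Lambda>) - {i} = insert n (insert \<rho> \<Lambda> - {i})"
        using ni by auto
      have 2: "?L i i = c {n, i} + (\<Sum>k\<in>insert \<rho> \<Lambda> - {i}. c {i, k})"
        unfolding lap_def 1 using fin n sw by simp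
      \<comment> \<open>The diagonal of the new Laplacian omits \<open>k = i\<close>; the omitted
        term \<open>c {n, i} * c {n, i} / C\<close> is the Schur correction.\<close>
      have 3: "C = c {n, i} + (\<Sum>k\<in>insert \<rho> \<Lambda> - {i}. c {n, k})"
        unfolding C using fin ij by (subst sum.remove[of _ i]) auto
      have "lap \<Lambda> \<rho> (star_mesh n c C) i i
          = (\<Sum>k\<in>insert \<rho> \<Lambda> - {i}. c {i, k} + c {n, i} * c {n, k} / C)"
        unfolding lap_def by (auto intro!: sum.cong star_mesh_doubleton)
      also have "\<dots> = (\<Sum>k\<in>insert \<rho> \<Lambda> - {i}. c {i, k}) + c {n, i} * (C - c {n, i}) / C"
        unfolding 3 by (simp add: sum.distrib sum_distrib_left sum_divide_distrib)
      also have "\<dots> = ?L i i - c {n, i} * c {n, i} / C"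
        unfolding 2 using C by (simp add: field_simps)
      finally show ?thesis
        using True ni nn sw by (simp add: lap_def)
    next
      case False
      then show ?thesis using ni nn sw unfolding lap_def star_mesh_def by simp
    qed
  qed
  finally show ?thesis unfolding nn .
qed

text \<open>The case in which elimination would divide by zero: nonnegative conductances with sum
  zero all vanish, and with them row \<open>n\<close>.\<close>

lemma set_det_lap_isolated:
  assumes fin: "finite \<Lambda>" and n: "n \<notin> insert \<rho> \<Lambda>"
    and c: "\<And>k. k \<in> insert \<rho> \<Lambda> \<Longrightarrow> 0 \<le> c {n, k}" and C: "(\<Sum>k\<in>insert \<rho> \<Lambda>. c {n, k}) = 0"
  shows "set_det (insert n \<Lambda>) (lap (insert n \<Lambda>) \<rho> c) = 0"
proof (rule set_det_zero_row[of _ n])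
  have z: "c {n, k} = 0" if "k \<in> insert \<rho> \<Lambda>" for k
    using C fin c that by (subst (asm) sum_nonneg_eq_0_iff) auto
  show "lap (insert n \<Lambda>) \<rho> c n j = 0" if "j \<in> insert n \<Lambda>" for j
    using that n z unfolding lap_def by (auto intro!: sum.neutral)
qed (use fin in auto)

lemma star_mesh_nonneg:
  assumes "\<And>e. e \<in> edges (insert n V) \<Longrightarrow> 0 \<le> c e" "n \<notin> V" "0 \<le> C" "e \<in> edges V"
  shows "0 \<le> star_mesh n c C e"
proof -
  have "0 \<le> c e" "\<And>i. i \<in> e \<Longrightarrow> 0 \<le> c {n, i}"
  proof -
    show "0 \<le> c e" using assms(4) by (intro assms(1)) (auto simp: edges_def)
    show "0 \<le> c {n, i}" if "i \<in> e" for i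
      using assms(2,4) that by (intro assms(1)) (auto simp: edges_def card_insert_if)
  qed
  then show ?thesis unfolding star_mesh_def using assms by (auto intro!: add_nonneg_nonneg divide_nonneg_nonneg prod_nonneg)
qed

lemma finite_edges: "finite V \<Longrightarrow> finite (edges V)"
  by (rule finite_subset[of _ "Pow V"]) (auto simp: edges_def)

lemma doubleton_edges: "i \<in> V \<Longrightarrow> j \<in> V \<Longrightarrow> i \<noteq> j \<Longrightarrow> {i, j} \<in> edges V"
  by (auto simp: edges_def)

text \<open>Induction on the vertices: eliminating one contributes a factor \<open>C \<ge> 0\<close>
  and keeps all conductances nonnegative. The induction runs over all \<open>c\<close> at once
  because elimination changes the conductances.\<close>

lemma set_det_lap_nonneg:
  assumes "finite \<Lambda>" "\<rho> \<notin> \<Lambda>" "\<And>e. e \<in> edges (insert \<rho> \<Lambda>) \<Longrightarrow> 0 \<le> c e"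
  shows "0 \<le> set_det \<Lambda> (lap \<Lambda> \<rho> c)"
  using assms
proof (induction \<Lambda> arbitrary: c rule: finite_induct)
  case (insert n \<Lambda>)
  let ?V = "insert \<rho> \<Lambda>"
  have ins: "insert \<rho> (insert n \<Lambda>) = insert n ?V" by auto
  have n: "n \<notin> ?V" using insert by auto
  have c: "0 \<le> c e" if "e \<in> edges (insert n ?V)" for e
    using insert.prems(2)[unfolded ins] that .
  have ck: "0 \<le> c {n, k}" if "k \<in> ?V" for k
    using that n by (intro c doubleton_edges) auto
  define C where "C = (\<Sum>k\<in>?V. c {n, k})"
  have C0: "0 \<le> C" unfolding C_def using ck by (rule sum_nonneg)
  show ?case
  proof (cases "C = 0")
    case True
    then show ?thesis using set_det_lap_isolated[of \<Lambda> n \<rho> c] insert.hyps n ck by (simp add: C_def)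
  next
    case False
    have "0 \<le> set_det \<Lambda> (lap \<Lambda> \<rho> (star_mesh n c C))"
      using insert.prems(1) star_mesh_nonneg[OF c n C0] by (intro insert.IH) auto
    then show ?thesis
      using set_det_lap_insert[OF insert.hyps(1) n C_def False] C0 by simp
  qed
qed simp

section \<open>Dependence of the determinant on a single weight\<close>

lemma star_mesh_upd:
  assumes "n \<notin> e"
  shows "star_mesh n (c(e := z)) C = (star_mesh n c C)(e := z + (\<Prod>i\<in>e. c {n, i}) / C)"
proof -
  have "{n, i} \<noteq> e" for i using assms by auto
  then show ?thesis by (simp add: star_mesh_def fun_eq_iff)
qed

text \<open>The determinant is an affine function \<open>p + q * z\<close> of a single weight \<open>z\<close>, with \<open>p, q \<ge> 0\<close>. This
  consequence of affinity is stable under the elimination of a vertex outside the edge, which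
  shifts \<open>z\<close> by a nonnegative constant.\<close>
definition edge_concave :: "'a set \<Rightarrow> 'a \<Rightarrow> 'a set \<Rightarrow> bool" where
  "edge_concave \<Lambda> \<rho> e \<longleftrightarrow> (\<forall>c z z'. (\<forall>e'\<in>edges (insert \<rho> \<Lambda>). 0 \<le> c e') \<longrightarrow> 0 < z' \<longrightarrow> z' \<le> z \<longrightarrow>
     set_det \<Lambda> (lap \<Lambda> \<rho> (c(e := z))) \<le> z / z' * set_det \<Lambda> (lap \<Lambda> \<rho> (c(e := z'))))"

lemma set_det_lap_singleton: "a \<noteq> \<rho> \<Longrightarrow> set_det {a} (lap {a} \<rho> c) = c {a, \<rho>}"
  using set_det_insert_zero_column[of "{}" a "lap {a} \<rho> c"]
  by (simp add: lap_def insert_Diff_if)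

lemma edge_concave_singleton:
  assumes "a \<noteq> \<rho>"
  shows "edge_concave {a} \<rho> {a, \<rho>}"
  using assms by (simp add: edge_concave_def set_det_lap_singleton)

text \<open>Base case for an edge that avoids \<open>\<rho>\<close>. The determinant runs over the
  three spanning trees of a triangle, two of which contain the edge \<open>{a, b}\<close>, so it is
  affine in that weight with nonnegative coefficients.\<close>

lemma edge_concave_doubleton:
  assumes "a \<noteq> \<rho>" "b \<noteq> \<rho>" "a \<noteq> b"
  shows "edge_concave {a, b} \<rho> {a, b}"
  unfolding edge_concave_def
proof (intro allI impI)
  fix c :: "'a set \<Rightarrow> real" and z z' :: real
  assume c: "\<forall>e'\<in>edges (insert \<rho> {a, b}). 0 \<le> c e'" and z: "0 < z'" "z' \<le> z"
  have c0: "0 \<le> c {a, \<rho>}" "0 \<le> c {b, \<rho>}"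
    using c assms by (auto simp: edges_def)
  have det: "set_det {a, b} (lap {a, b} \<rho> (c({a, b} := x)))
      = c {a, \<rho>} * c {b, \<rho>} + x * (c {a, \<rho>} + c {b, \<rho>})" if "x > 0" for x
  proof -
    let ?c = "c({a, b} := x)"
    let ?C = "\<Sum>k\<in>{\<rho>, b}. ?c {a, k}"
    have ne: "{a, \<rho>} \<noteq> {a, b}" "{b, \<rho>} \<noteq> {a, b}" using assms by auto
    have C: "?C = c {a, \<rho>} + x" using assms ne by simp
    have "set_det {a, b} (lap {a, b} \<rho> ?c) = ?C * set_det {b} (lap {b} \<rho> (star_mesh a ?c ?C))"
      by (rule set_det_lap_insert) (use assms C c0 \<open>x > 0\<close> in auto)
    also have "set_det {b} (lap {b} \<rho> (star_mesh a ?c ?C)) = star_mesh a ?c ?C {b, \<rho>}"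
      using assms(2) by (rule set_det_lap_singleton)
    also have "\<dots> = c {b, \<rho>} + x * c {a, \<rho>} / ?C"
      using assms ne by (simp add: star_mesh_doubleton)
    finally have "set_det {a, b} (lap {a, b} \<rho> ?c)
        = (c {a, \<rho>} + x) * (c {b, \<rho>} + x * c {a, \<rho>} / (c {a, \<rho>} + x))"
      unfolding C .
    also have "\<dots> = c {a, \<rho>} * c {b, \<rho>} + x * (c {a, \<rho>} + c {b, \<rho>})"
      using c0 \<open>x > 0\<close> by (simp add: field_simps)
    finally show ?thesis .
  qed
  have "c {a, \<rho>} * c {b, \<rho>} \<le> z / z' * (c {a, \<rho>} * c {b, \<rho>})"
    using mult_right_mono[of 1 "z / z'" "c {a, \<rho>} * c {b, \<rho>}"] z c0 by simp
  then show "set_det {a, b} (lap {a, b} \<rho> (c({a, b} := z)))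
      \<le> z / z' * set_det {a, b} (lap {a, b} \<rho> (c({a, b} := z')))"
    using z by (simp add: det distrib_left)
qed

lemma edge_concave_insert:
  assumes IH: "edge_concave \<Lambda> \<rho> e" and fin: "finite \<Lambda>" and \<rho>: "\<rho> \<notin> \<Lambda>"
    and n: "n \<notin> insert \<rho> \<Lambda>" and e: "e \<subseteq> insert \<rho> \<Lambda>" "card e = 2"
  shows "edge_concave (insert n \<Lambda>) \<rho> e"
  unfolding edge_concave_def
proof (intro allI impI)
  fix c :: "'a set \<Rightarrow> real" and z z' :: real
  assume c: "\<forall>e'\<in>edges (insert \<rho> (insert n \<Lambda>)). 0 \<le> c e'" and z: "0 < z'" "z' \<le> z"
  let ?V = "insert \<rho> \<Lambda>"
  have ins: "insert \<rho> (insert n \<Lambda>) = insert n ?V" by auto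
  have ne: "n \<notin> e" "{n, k} \<noteq> e" for k using n e by auto
  have c0: "0 \<le> c e'" if "e' \<in> edges (insert n ?V)" for e' using c that ins by metis
  have ck: "0 \<le> c {n, k}" if "k \<in> ?V" for k
    using that n by (intro c0 doubleton_edges) auto
  define C where "C = (\<Sum>k\<in>?V. c {n, k})"
  have C_upd: "C = (\<Sum>k\<in>?V. (c(e := x)) {n, k})" for x
    unfolding C_def using ne by simp
  have C0: "0 \<le> C" unfolding C_def using ck by (rule sum_nonneg)
  let ?M = "insert n \<Lambda>"
  show "set_det ?M (lap ?M \<rho> (c(e := z))) \<le> z / z' * set_det ?M (lap ?M \<rho> (c(e := z')))"
  proof (cases "C = 0")
    case True
    have "set_det ?M (lap ?M \<rho> (c(e := x))) = 0" for x
      using fin n ck ne C_upd[of x] True by (intro set_det_lap_isolated) auto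
    then show ?thesis by simp
  next
    case False
    define p where "p = (\<Prod>i\<in>e. c {n, i}) / C"
    have p: "0 \<le> p" unfolding p_def
      using C0 ck e by (intro divide_nonneg_nonneg prod_nonneg) auto
    let ?d = "star_mesh n c C"
    have det: "set_det ?M (lap ?M \<rho> (c(e := x))) = C * set_det \<Lambda> (lap \<Lambda> \<rho> (?d(e := x + p)))" for x
      using set_det_lap_insert[OF fin n, of C "c(e := x)"] C_upd[of x] False star_mesh_upd[OF ne(1)]
      by (simp add: p_def del: fun_upd_apply)
    have d: "\<forall>e'\<in>edges ?V. 0 \<le> ?d e'"
      using star_mesh_nonneg[of n ?V c C] c0 n C0 by auto
    have "set_det \<Lambda> (lap \<Lambda> \<rho> (?d(e := z + p)))
        \<le> (z + p) / (z' + p) * set_det \<Lambda> (lap \<Lambda> \<rho> (?d(e := z' + p)))"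
      using IH d z p unfolding edge_concave_def by auto
    \<comment> \<open>Adding the same \<open>p \<ge> 0\<close> to \<open>z\<close> and
      \<open>z'\<close> only moves their ratio towards 1.\<close>
    also have "\<dots> \<le> z / z' * set_det \<Lambda> (lap \<Lambda> \<rho> (?d(e := z' + p)))"
    proof (rule mult_right_mono)
      show "(z + p) / (z' + p) \<le> z / z'" using z p by (simp add: field_simps mult_left_mono)
      show "0 \<le> set_det \<Lambda> (lap \<Lambda> \<rho> (?d(e := z' + p)))"
        using fin \<rho> d z p by (intro set_det_lap_nonneg) auto
    qed
    finally have "C * set_det \<Lambda> (lap \<Lambda> \<rho> (?d(e := z + p)))
        \<le> C * (z / z' * set_det \<Lambda> (lap \<Lambda> \<rho> (?d(e := z' + p))))"
      using C0 by (rule mult_left_mono)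
    then show ?thesis unfolding det by (simp only: mult.left_commute)
  qed
qed

text \<open>On the endpoints of \<open>e\<close> other than \<open>\<rho>\<close> the determinant is
  explicit; the remaining vertices are then added one at a time.\<close>

lemma edge_concave_edge:
  assumes fin: "finite \<Lambda>" and \<rho>: "\<rho> \<notin> \<Lambda>" and e: "e \<in> edges (insert \<rho> \<Lambda>)"
  shows "edge_concave \<Lambda> \<rho> e"
proof -
  have step: "edge_concave (M \<union> \<Lambda>0) \<rho> e"
    if "finite M" "M \<inter> \<Lambda>0 = {}" "\<rho> \<notin> M \<union> \<Lambda>0" "finite \<Lambda>0" "edge_concave \<Lambda>0 \<rho> e" "e \<subseteq> insert \<rho> \<Lambda>0"
    for M \<Lambda>0
    using that e
  proof (induction M rule: finite_induct)
    case (insert n M)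
    have "edge_concave (insert n (M \<union> \<Lambda>0)) \<rho> e"
      using insert by (intro edge_concave_insert) (auto simp: edges_def)
    then show ?case by simp
  qed simp
  from e obtain a b where ab: "e = {a, b}" "a \<noteq> b" by (auto simp: edges_def card_2_iff)
  have conc: "edge_concave (e - {\<rho>}) \<rho> e"
  proof -
    consider "a = \<rho>" | "b = \<rho>" | "a \<noteq> \<rho>" "b \<noteq> \<rho>" by blast
    then show ?thesis
    proof cases
      case 1
      then have "e = {b, \<rho>}" "e - {\<rho>} = {b}" using ab by auto
      then show ?thesis using edge_concave_singleton[of b \<rho>] ab 1 by simp
    next
      case 2
      then have "e - {\<rho>} = {a}" using ab by auto
      then show ?thesis using edge_concave_singleton[of a \<rho>] ab 2 by simp
    next
      case 3
      then have "e - {\<rho>} = {a, b}" using ab by auto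
      then show ?thesis using edge_concave_doubleton[of a \<rho> b] ab 3 by simp
    qed
  qed
  have "edge_concave ((\<Lambda> - e) \<union> (e - {\<rho>})) \<rho> e"
    using conc fin \<rho> e ab by (intro step) auto
  moreover have "(\<Lambda> - e) \<union> (e - {\<rho>}) = \<Lambda>" using e \<rho> by (auto simp: edges_def)
  ultimately show ?thesis by simp
qed

text \<open>The weights in \<open>U\<close> are lowered one at a time, each at the price of one
  ratio \<open>c e / c' e\<close>.\<close>

lemma set_det_lap_le_prod:
  assumes fin: "finite \<Lambda>" and \<rho>: "\<rho> \<notin> \<Lambda>" and U: "U \<subseteq> edges (insert \<rho> \<Lambda>)"
    and c: "\<And>e. e \<in> edges (insert \<rho> \<Lambda>) \<Longrightarrow> 0 \<le> c e"
    and c': "\<And>e. e \<in> U \<Longrightarrow> 0 < c' e \<and> c' e \<le> c e"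
    and eq: "\<And>e. e \<in> edges (insert \<rho> \<Lambda>) - U \<Longrightarrow> c' e = c e"
  shows "set_det \<Lambda> (lap \<Lambda> \<rho> c) \<le> (\<Prod>e\<in>U. c e / c' e) * set_det \<Lambda> (lap \<Lambda> \<rho> c')"
proof -
  have "finite U" using U fin by (auto intro: finite_subset finite_edges)
  then have "set_det \<Lambda> (lap \<Lambda> \<rho> c) \<le> (\<Prod>e\<in>U. c e / c' e) * set_det \<Lambda> (lap \<Lambda> \<rho> (\<lambda>e. if e \<in> U then c' e else c e))"
    using U c'
  proof (induction U rule: finite_induct)
    case (insert x U)
    let ?f = "\<lambda>U e. if e \<in> U then c' e else c e"
    have upd: "(?f U)(x := c x) = ?f U" "(?f U)(x := c' x) = ?f (insert x U)"
      using insert.hyps by (auto simp: fun_eq_iff)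
    have "set_det \<Lambda> (lap \<Lambda> \<rho> ((?f U)(x := c x))) \<le> c x / c' x * set_det \<Lambda> (lap \<Lambda> \<rho> ((?f U)(x := c' x)))"
    proof -
      have "edge_concave \<Lambda> \<rho> x" using insert.prems fin \<rho> by (intro edge_concave_edge) auto
      moreover have "\<forall>e\<in>edges (insert \<rho> \<Lambda>). 0 \<le> ?f U e"
        using c insert.prems(2) by (simp add: less_imp_le)
      ultimately show ?thesis
        using insert.prems(2)[of x]
        unfolding edge_concave_def by (simp del: fun_upd_apply)
    qed
    then have *: "set_det \<Lambda> (lap \<Lambda> \<rho> (?f U)) \<le> c x / c' x * set_det \<Lambda> (lap \<Lambda> \<rho> (?f (insert x U)))"
      unfolding upd .
    have "set_det \<Lambda> (lap \<Lambda> \<rho> c) \<le> (\<Prod>e\<in>U. c e / c' e) * set_det \<Lambda> (lap \<Lambda> \<rho> (?f U))"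
      by (rule insert.IH) (use insert.prems in auto)
    also have "\<dots> \<le> (\<Prod>e\<in>U. c e / c' e) * (c x / c' x * set_det \<Lambda> (lap \<Lambda> \<rho> (?f (insert x U))))"
    proof (intro mult_left_mono[OF *] prod_nonneg ballI)
      fix e assume "e \<in> U"
      then show "0 \<le> c e / c' e" using insert.prems(2)[of e] by auto
    qed
    also have "\<dots> = (\<Prod>e\<in>insert x U. c e / c' e) * set_det \<Lambda> (lap \<Lambda> \<rho> (?f (insert x U)))"
      using insert.hyps by (simp add: mult_ac)
    finally show ?case .
  qed simp
  also have "set_det \<Lambda> (lap \<Lambda> \<rho> (\<lambda>e. if e \<in> U then c' e else c e)) = set_det \<Lambda> (lap \<Lambda> \<rho> c')"
  proof (rule set_det_lap_cong)
    fix i j assume "i \<in> \<Lambda>" "j \<in> insert \<rho> \<Lambda>" "i \<noteq> j"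
    then have "{i, j} \<in> edges (insert \<rho> \<Lambda>)" by (intro doubleton_edges) auto
    then show "(if {i, j} \<in> U then c' {i, j} else c {i, j}) = c' {i, j}" using eq by auto
  qed
  finally show ?thesis .
qed

section \<open>Elimination of a vertex from the density\<close>

text \<open>The product over the endpoints yields the factor \<open>exp (u i + u j)\<close> without
  ordering the edge. With these conductances \<open>D_mat\<close> is a Laplacian.\<close>

definition conductance :: "'a \<Rightarrow> ('a set \<Rightarrow> real) \<Rightarrow> ('a \<Rightarrow> real) \<Rightarrow> 'a set \<Rightarrow> real" where
  "conductance \<rho> W u e = W e * (\<Prod>i\<in>e. exp (pin \<rho> u i))"

lemma conductance_doubleton:
  "i \<noteq> j \<Longrightarrow> conductance \<rho> W u {i, j} = W {i, j} * exp (pin \<rho> u i + pin \<rho> u j)"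
  by (simp add: conductance_def exp_add)

lemma conductance_nonneg: "0 \<le> W e \<Longrightarrow> 0 \<le> conductance \<rho> W u e"
  by (simp add: conductance_def prod_nonneg)

lemma set_det_D_mat:
  assumes "\<rho> \<notin> \<Lambda>"
  shows "set_det \<Lambda> (D_mat \<Lambda> \<rho> W u) = set_det \<Lambda> (lap \<Lambda> \<rho> (conductance \<rho> W u))"
proof (rule set_det_cong)
  fix i j assume "i \<in> \<Lambda>" "j \<in> \<Lambda>"
  have "(\<Sum>k\<in>insert \<rho> \<Lambda> - {i}. W {i, k} * exp (pin \<rho> u i + pin \<rho> u k))
      = (\<Sum>k\<in>insert \<rho> \<Lambda> - {i}. conductance \<rho> W u {i, k})"
    by (intro sum.cong refl conductance_doubleton[symmetric]) auto
  then show "D_mat \<Lambda> \<rho> W u i j = lap \<Lambda> \<rho> (conductance \<rho> W u) i j"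
    by (auto simp: D_mat_def lap_def conductance_doubleton)
qed

text \<open>A sum over ordered pairs, whose diagonal terms vanish because \<open>B_pair \<rho> u s i i = 1\<close>.\<close>
definition energy :: "'a \<Rightarrow> 'a set \<Rightarrow> ('a set \<Rightarrow> real) \<Rightarrow> ('a \<Rightarrow> real) \<Rightarrow> ('a \<Rightarrow> real) \<Rightarrow> real" where
  "energy \<rho> V W u s = (\<Sum>i\<in>V. \<Sum>j\<in>V. W {i, j} * (B_pair \<rho> u s i j - 1)) / 2"

text \<open>The density of \<open>mu\<close> in a form suited to elimination: edges of weight zero
  are kept in the exponent, and no order on the vertices is involved.\<close>

definition pdens :: "'a set \<Rightarrow> 'a \<Rightarrow> ('a set \<Rightarrow> real) \<Rightarrow> ('a \<Rightarrow> real) \<Rightarrow> ('a \<Rightarrow> real) \<Rightarrow> real" where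
  "pdens \<Lambda> \<rho> W u s = exp (- energy \<rho> (insert \<rho> \<Lambda>) W u s) * set_det \<Lambda> (D_mat \<Lambda> \<rho> W u)
     * (\<Prod>i\<in>\<Lambda>. exp (- u i) / (2 * pi))"

lemma B_pair_refl [simp]: "B_pair \<rho> u s i i = 1"
  by (simp add: B_pair_def)

lemma energy_insert:
  assumes "finite V" "n \<notin> V"
  shows "energy \<rho> (insert n V) W u s
       = energy \<rho> V W u s + (\<Sum>j\<in>V. W {n, j} * (B_pair \<rho> u s n j - 1))"
proof -
  have "(\<Sum>i\<in>V. W {i, n} * (B_pair \<rho> u s i n - 1)) = (\<Sum>j\<in>V. W {n, j} * (B_pair \<rho> u s n j - 1))"
    by (intro sum.cong refl) (simp add: insert_commute B_pair_commute)
  then show ?thesis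
    using assms by (simp add: energy_def sum.distrib add_divide_distrib)
qed

text \<open>\<open>cosh (U i - U j)\<close> is the average of \<open>exp (U i - U j)\<close> and
  \<open>exp (U j - U i)\<close>, and each of the two double sums factorizes.\<close>

lemma sum_cosh_diff:
  fixes a U :: "'a \<Rightarrow> real"
  shows "(\<Sum>i\<in>V. \<Sum>j\<in>V. a i * a j * cosh (U i - U j))
       = (\<Sum>j\<in>V. a j * exp (U j)) * (\<Sum>j\<in>V. a j * exp (- U j))"
proof -
  let ?A = "\<Sum>j\<in>V. a j * exp (U j)" and ?A' = "\<Sum>j\<in>V. a j * exp (- U j)"
  have "a i * a j * cosh (U i - U j) = ((a i * exp (U i)) * (a j * exp (- U j)) + (a i * exp (- U i)) * (a j * exp (U j))) / 2" for i j
    by (simp add: cosh_def exp_diff exp_minus field_simps)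
  then have "(\<Sum>i\<in>V. \<Sum>j\<in>V. a i * a j * cosh (U i - U j))
      = (\<Sum>i\<in>V. \<Sum>j\<in>V. ((a i * exp (U i)) * (a j * exp (- U j)) + (a i * exp (- U i)) * (a j * exp (U j))) / 2)"
    by (simp only:)
  also have "\<dots> = (?A * ?A' + ?A' * ?A) / 2"
    unfolding sum_product by (simp add: sum.distrib sum_divide_distrib add_divide_distrib)
  finally have "(\<Sum>i\<in>V. \<Sum>j\<in>V. a i * a j * cosh (U i - U j)) = (?A * ?A' + ?A' * ?A) / 2" .
  then show ?thesis by simp
qed

text \<open>The square is completed around the weighted mean \<open>m\<close>. The remaining
  variance is written as a sum over pairs, the form in which it can be read as an energy.\<close>

lemma weighted_square_sum:
  fixes q T :: "'a \<Rightarrow> real"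
  assumes C: "C = (\<Sum>j\<in>V. q j)" "C \<noteq> 0" and m: "m = (\<Sum>j\<in>V. q j * T j) / C"
  shows "(\<Sum>j\<in>V. q j * (x - T j)\<^sup>2)
       = C * (x - m)\<^sup>2 + (\<Sum>i\<in>V. \<Sum>j\<in>V. q i * q j * (T i - T j)\<^sup>2) / (2 * C)"
proof -
  let ?Q = "\<Sum>j\<in>V. q j * (T j)\<^sup>2" and ?P = "\<Sum>j\<in>V. q j * T j"
  have "q i * q j * (T i - T j)\<^sup>2
      = (q i * (T i)\<^sup>2) * q j + q i * (q j * (T j)\<^sup>2) - 2 * ((q i * T i) * (q j * T j))" for i j
    by (simp add: power2_eq_square algebra_simps)
  then have 1: "(\<Sum>i\<in>V. \<Sum>j\<in>V. q i * q j * (T i - T j)\<^sup>2) = 2 * C * ?Q - 2 * ?P\<^sup>2"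
    by (simp add: sum.distrib sum_subtractf sum_distrib_left[symmetric] sum_distrib_right[symmetric]
        C(1) power2_eq_square)
  have "q j * (x - T j)\<^sup>2 = x\<^sup>2 * q j - 2 * x * (q j * T j) + q j * (T j)\<^sup>2" for j
    by (simp add: power2_eq_square algebra_simps)
  then have 2: "(\<Sum>j\<in>V. q j * (x - T j)\<^sup>2) = x\<^sup>2 * C - 2 * x * ?P + ?Q"
    by (simp add: sum.distrib sum_subtractf sum_distrib_left[symmetric] C(1))
  show ?thesis
    unfolding 1 2 m using C(2) by (simp add: power2_eq_square field_simps)
qed

text \<open>Since \<open>A = y * exp x\<close>, the sum of the \<open>cosh\<close> terms depends on
  \<open>y\<close> and on a product that \<open>sum_cosh_diff\<close> turns into a double sum.
  Completing the square in \<open>\<sigma>\<close> gives a double sum for the quadratic terms. The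
  leftover terms in \<open>y\<close> and \<open>S\<close> combine to
  \<open>(y - S)\<^sup>2 / (2 * y)\<close>.\<close>

lemma energy_star:
  fixes a U T :: "'a \<Rightarrow> real"
  assumes A: "A = (\<Sum>j\<in>V. a j * exp (U j))" "A > 0" and x: "x = ln A + t" and y: "y = exp (- t)"
    and S: "S = (\<Sum>j\<in>V. a j)" and C: "C = y * exp (2 * x)"
    and m: "m = (\<Sum>j\<in>V. a j * exp (x + U j) * T j) / C"
  shows "(\<Sum>j\<in>V. a j * (cosh (x - U j) + 1 / 2 * (\<sigma> - T j)\<^sup>2 * exp (x + U j) - 1))
       = (y - S)\<^sup>2 / (2 * y) + C * (\<sigma> - m)\<^sup>2 / 2
         + (\<Sum>i\<in>V. \<Sum>j\<in>V. a i * a j / y * (cosh (U i - U j) + 1 / 2 * (T i - T j)\<^sup>2 * exp (U i + U j) - 1)) / 2"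
proof -
  let ?A' = "\<Sum>j\<in>V. a j * exp (- U j)"
  have y0: "y > 0" and C0: "C > 0" using y C by auto
  have ex: "exp x = A / y" using A(2) by (simp add: x y exp_add exp_minus field_simps)
  have exm: "exp (- x) = y / A" using ex by (simp add: exp_minus)
  \<comment> \<open>\<open>C\<close> is the total conductance at the eliminated vertex, hence the
    normalization of the weights \<open>a j * exp (x + U j)\<close> whose mean is
    \<open>m\<close>.\<close>
  have CA: "C = (\<Sum>j\<in>V. a j * exp (x + U j))"
  proof -
    have "(\<Sum>j\<in>V. a j * exp (x + U j)) = exp x * A"
      unfolding A(1) sum_distrib_left by (intro sum.cong refl) (simp add: exp_add)
    moreover have "exp (2 * x) = exp x * exp x" by (simp add: exp_add[symmetric])
    ultimately show ?thesis unfolding C ex using y0 by simp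
  qed
  have cosh: "(\<Sum>j\<in>V. a j * cosh (x - U j)) = (y + A * ?A' / y) / 2"
  proof -
    have "a j * cosh (x - U j) = (exp (- x) * (a j * exp (U j)) + exp x * (a j * exp (- U j))) / 2" for j
      by (simp add: cosh_def exp_diff exp_minus field_simps)
    then have "(\<Sum>j\<in>V. a j * cosh (x - U j))
        = (\<Sum>j\<in>V. (exp (- x) * (a j * exp (U j)) + exp x * (a j * exp (- U j))) / 2)"
      by (simp only:)
    also have "\<dots> = (exp (- x) * A + exp x * ?A') / 2"
      by (simp add: sum.distrib sum_distrib_left[symmetric] sum_divide_distrib[symmetric] A(1))
    finally have "(\<Sum>j\<in>V. a j * cosh (x - U j)) = (exp (- x) * A + exp x * ?A') / 2" .
    then show ?thesis unfolding ex exm using A(2) by simp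
  qed
  have sq: "(\<Sum>j\<in>V. a j * exp (x + U j) * (\<sigma> - T j)\<^sup>2)
      = C * (\<sigma> - m)\<^sup>2 + (\<Sum>i\<in>V. \<Sum>j\<in>V. a i * a j / y * ((T i - T j)\<^sup>2 * exp (U i + U j))) / 2"
  proof -
    have "(a i * exp (x + U i)) * (a j * exp (x + U j)) * (T i - T j)\<^sup>2
        = C * (a i * a j / y * ((T i - T j)\<^sup>2 * exp (U i + U j)))" for i j
      using y0 exp_add[of x x] by (simp add: C exp_add field_simps)
    then have "(\<Sum>i\<in>V. \<Sum>j\<in>V. (a i * exp (x + U i)) * (a j * exp (x + U j)) * (T i - T j)\<^sup>2)
        = C * (\<Sum>i\<in>V. \<Sum>j\<in>V. a i * a j / y * ((T i - T j)\<^sup>2 * exp (U i + U j)))"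
      unfolding sum_distrib_left by (simp only:)
    then show ?thesis
      using weighted_square_sum[OF CA _ m, of \<sigma>] C0 by simp
  qed
  let ?R = "\<Sum>i\<in>V. \<Sum>j\<in>V. a i * a j / y * ((T i - T j)\<^sup>2 * exp (U i + U j))"
  have R: "(\<Sum>i\<in>V. \<Sum>j\<in>V. a i * a j / y * (cosh (U i - U j) + 1 / 2 * (T i - T j)\<^sup>2 * exp (U i + U j) - 1))
      = (A * ?A' - S\<^sup>2) / y + ?R / 2"
  proof -
    have "a i * a j / y * (cosh (U i - U j) + 1 / 2 * (T i - T j)\<^sup>2 * exp (U i + U j) - 1)
        = a i * a j * cosh (U i - U j) / y - a i * a j / y
          + a i * a j / y * ((T i - T j)\<^sup>2 * exp (U i + U j)) / 2" for i j
      by (simp add: algebra_simps diff_divide_distrib add_divide_distrib)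
    then have "(\<Sum>i\<in>V. \<Sum>j\<in>V. a i * a j / y * (cosh (U i - U j) + 1 / 2 * (T i - T j)\<^sup>2 * exp (U i + U j) - 1))
        = (\<Sum>i\<in>V. \<Sum>j\<in>V. a i * a j * cosh (U i - U j)) / y - (\<Sum>i\<in>V. \<Sum>j\<in>V. a i * a j) / y + ?R / 2"
      by (simp add: sum.distrib sum_subtractf sum_divide_distrib[symmetric])
    then show ?thesis
      unfolding sum_cosh_diff A(1)[symmetric] by (simp add: S power2_eq_square sum_product diff_divide_distrib)
  qed
  have "a j * (cosh (x - U j) + 1 / 2 * (\<sigma> - T j)\<^sup>2 * exp (x + U j) - 1)
      = a j * cosh (x - U j) + a j * exp (x + U j) * (\<sigma> - T j)\<^sup>2 / 2 - a j" for j
    by (simp add: algebra_simps)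
  then have "(\<Sum>j\<in>V. a j * (cosh (x - U j) + 1 / 2 * (\<sigma> - T j)\<^sup>2 * exp (x + U j) - 1))
      = (\<Sum>j\<in>V. a j * cosh (x - U j)) + (\<Sum>j\<in>V. a j * exp (x + U j) * (\<sigma> - T j)\<^sup>2) / 2 - S"
    by (simp add: sum.distrib sum_subtractf sum_divide_distrib[symmetric] S)
  also have "\<dots> = (y - S)\<^sup>2 / (2 * y) + C * (\<sigma> - m)\<^sup>2 / 2 + ((A * ?A' - S\<^sup>2) / y + ?R / 2) / 2"
    unfolding cosh sq using y0 by (simp add: field_simps power2_eq_square)
  finally show ?thesis unfolding R .
qed

lemma pin_upd: "n \<noteq> \<rho> \<Longrightarrow> pin \<rho> (u(n := x)) = (pin \<rho> u)(n := x)"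
  by (auto simp: pin_def)

text \<open>By \<open>energy_star\<close> the star at \<open>n\<close> splits into the energy of the
  added star-mesh weights, a term in \<open>y\<close> and a Gaussian exponent in
  \<open>\<sigma>\<close>; the determinant contributes the factor \<open>C\<close>. Taking
  \<open>t\<close> as variable makes the reduced weights independent of \<open>u\<close> and
  \<open>s\<close>.\<close>

lemma pdens_insert:
  assumes fin: "finite \<Lambda>" and n: "n \<notin> insert \<rho> \<Lambda>" and \<rho>: "\<rho> \<notin> \<Lambda>"
    and A: "A = (\<Sum>j\<in>insert \<rho> \<Lambda>. W {n, j} * exp (pin \<rho> u j))" "A > 0"
    and x: "x = ln A + t" and y: "y = exp (- t)"
    and S: "S = (\<Sum>j\<in>insert \<rho> \<Lambda>. W {n, j})" and C: "C = y * exp (2 * x)"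
    and m: "m = (\<Sum>j\<in>insert \<rho> \<Lambda>. W {n, j} * exp (x + pin \<rho> u j) * pin \<rho> s j) / C"
  shows "pdens (insert n \<Lambda>) \<rho> W (u(n := x)) (s(n := \<sigma>))
       = pdens \<Lambda> \<rho> (star_mesh n W y) u s
         * (exp (- ((y - S)\<^sup>2 / (2 * y))) * (y * exp x / (2 * pi)) * exp (- (C * (\<sigma> - m)\<^sup>2 / 2)))"
proof -
  let ?V = "insert \<rho> \<Lambda>" and ?u = "u(n := x)" and ?s = "s(n := \<sigma>)"
  let ?W = "star_mesh n W y"
  have nV: "n \<notin> ?V" "n \<noteq> \<rho>" and finV: "finite ?V" using n fin by auto
  have y0: "y > 0" and C0: "C > 0" using y C by auto
  have pV: "pin \<rho> ?u j = pin \<rho> u j" "pin \<rho> ?s j = pin \<rho> s j" if "j \<in> ?V" for j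
    using that nV by (auto simp: pin_upd)
  have pn: "pin \<rho> ?u n = x" "pin \<rho> ?s n = \<sigma>" using nV by (auto simp: pin_upd)
  have E1: "energy \<rho> ?V W ?u ?s = energy \<rho> ?V W u s"
    unfolding energy_def B_pair_def by (intro arg_cong[of _ _ "\<lambda>x. x / 2"] sum.cong refl) (simp add: pV)
  have E2: "(\<Sum>j\<in>?V. W {n, j} * (B_pair \<rho> ?u ?s n j - 1))
      = (y - S)\<^sup>2 / (2 * y) + C * (\<sigma> - m)\<^sup>2 / 2
        + (\<Sum>i\<in>?V. \<Sum>j\<in>?V. W {n, i} * W {n, j} / y * (B_pair \<rho> u s i j - 1)) / 2"
  proof -
    have "(\<Sum>j\<in>?V. W {n, j} * (B_pair \<rho> ?u ?s n j - 1))
        = (\<Sum>j\<in>?V. W {n, j} * (cosh (x - pin \<rho> u j) + 1 / 2 * (\<sigma> - pin \<rho> s j)\<^sup>2 * exp (x + pin \<rho> u j) - 1))"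
      unfolding B_pair_def by (intro sum.cong refl) (simp add: pV pn)
    then show ?thesis
      unfolding energy_star[OF A x y S C m, of \<sigma>] by (simp add: B_pair_def)
  qed
  have E3: "energy \<rho> ?V ?W u s = energy \<rho> ?V W u s
        + (\<Sum>i\<in>?V. \<Sum>j\<in>?V. W {n, i} * W {n, j} / y * (B_pair \<rho> u s i j - 1)) / 2"
  proof -
    have "?W {i, j} * (B_pair \<rho> u s i j - 1) = W {i, j} * (B_pair \<rho> u s i j - 1)
        + W {n, i} * W {n, j} / y * (B_pair \<rho> u s i j - 1)" for i j
      by (cases "i = j") (auto simp: star_mesh_doubleton algebra_simps)
    then show ?thesis unfolding energy_def by (simp add: sum.distrib add_divide_distrib)
  qed
  have ins: "insert \<rho> (insert n \<Lambda>) = insert n ?V" by auto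
  have E: "energy \<rho> (insert \<rho> (insert n \<Lambda>)) W ?u ?s
      = energy \<rho> ?V ?W u s + (y - S)\<^sup>2 / (2 * y) + C * (\<sigma> - m)\<^sup>2 / 2"
    unfolding ins energy_insert[OF finV nV(1)] E1 E2 E3 by simp
  have D: "set_det (insert n \<Lambda>) (D_mat (insert n \<Lambda>) \<rho> W ?u) = C * set_det \<Lambda> (D_mat \<Lambda> \<rho> ?W u)"
  proof -
    let ?c = "conductance \<rho> W ?u"
    have c: "?c {n, k} = W {n, k} * exp (x + pin \<rho> u k)" if "k \<in> ?V" for k
      using that nV(1) pn pV by (subst conductance_doubleton) auto
    have CA: "C = (\<Sum>k\<in>?V. ?c {n, k})"
    proof -
      have "(\<Sum>k\<in>?V. ?c {n, k}) = exp x * A"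
        unfolding A(1) sum_distrib_left by (intro sum.cong refl) (simp add: c exp_add)
      moreover have "exp x = A / y" using A(2) by (simp add: x y exp_add exp_minus field_simps)
      moreover have "exp (2 * x) = exp x * exp x" by (simp add: exp_add[symmetric])
      ultimately show ?thesis unfolding C using y0 by simp
    qed
    have "set_det (insert n \<Lambda>) (lap (insert n \<Lambda>) \<rho> ?c) = C * set_det \<Lambda> (lap \<Lambda> \<rho> (star_mesh n ?c C))"
      by (rule set_det_lap_insert[OF fin n CA]) (use C0 in simp)
    also have "set_det \<Lambda> (lap \<Lambda> \<rho> (star_mesh n ?c C)) = set_det \<Lambda> (lap \<Lambda> \<rho> (conductance \<rho> ?W u))"
    proof (rule set_det_lap_cong)
      fix i j assume ij: "i \<in> \<Lambda>" "j \<in> ?V" "i \<noteq> j"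
      \<comment> \<open>Star-mesh on conductances with total \<open>C\<close> agrees with star-mesh
        on weights with total \<open>y\<close>: the two factors \<open>exp x\<close> cancel against
        \<open>C = y * exp (2 * x)\<close>.\<close>
      have "W {n, i} * exp (x + pin \<rho> u i) * (W {n, j} * exp (x + pin \<rho> u j)) / C
          = W {n, i} * W {n, j} / y * exp (pin \<rho> u i + pin \<rho> u j)"
        using y0 exp_add[of x x] by (simp add: C exp_add field_simps)
      then show "star_mesh n ?c C {i, j} = conductance \<rho> ?W u {i, j}"
        using ij c[of i] c[of j] pV[of i] pV[of j]
        by (simp add: star_mesh_doubleton conductance_doubleton algebra_simps)
    qed
    finally have "set_det (insert n \<Lambda>) (lap (insert n \<Lambda>) \<rho> ?c) = C * set_det \<Lambda> (lap \<Lambda> \<rho> (conductance \<rho> ?W u))" .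
    moreover have "\<rho> \<notin> insert n \<Lambda>" using \<rho> nV by auto
    ultimately show ?thesis unfolding set_det_D_mat[OF \<rho>] by (subst set_det_D_mat)
  qed
  have P: "(\<Prod>i\<in>insert n \<Lambda>. exp (- ?u i) / (2 * pi)) = exp (- x) / (2 * pi) * (\<Prod>i\<in>\<Lambda>. exp (- u i) / (2 * pi))"
    using fin n by (auto intro!: prod.cong)
  \<comment> \<open>The factor \<open>C\<close> of the determinant and the factor
    \<open>exp (- x)\<close> of the reference measure combine to the prefactor of the Gaussian in
    \<open>\<sigma>\<close>.\<close>
  have Cx: "C * exp (- x) = y * exp x"
    using exp_add[of "2 * x" "- x"] by (simp add: C mult.assoc)
  have arrange: "E * G * H * (C * d) * (exp (- x) / (2 * pi) * P) = E * d * P * (G * (y * exp x / (2 * pi)) * H)"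
    for E G H d P
  proof -
    have "E * G * H * (C * d) * (exp (- x) / (2 * pi) * P) = (C * exp (- x)) * (E * G * H * d * P / (2 * pi))"
      by simp
    then show ?thesis unfolding Cx by simp
  qed
  have "exp (- (energy \<rho> ?V ?W u s + (y - S)\<^sup>2 / (2 * y) + C * (\<sigma> - m)\<^sup>2 / 2))
      = exp (- energy \<rho> ?V ?W u s) * exp (- ((y - S)\<^sup>2 / (2 * y))) * exp (- (C * (\<sigma> - m)\<^sup>2 / 2))"
    by (simp add: exp_add[symmetric])
  then show ?thesis unfolding pdens_def E D P by (simp only: arrange)
qed

lemma pdens_nonneg:
  assumes "finite \<Lambda>" "\<rho> \<notin> \<Lambda>" "\<And>e. e \<in> edges (insert \<rho> \<Lambda>) \<Longrightarrow> 0 \<le> W e"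
  shows "0 \<le> pdens \<Lambda> \<rho> W u s"
  unfolding pdens_def set_det_D_mat[OF assms(2)]
  by (intro mult_nonneg_nonneg prod_nonneg set_det_lap_nonneg assms conductance_nonneg) auto

lemma pdens_isolated:
  assumes "finite \<Lambda>" "n \<notin> insert \<rho> \<Lambda>" "\<rho> \<notin> \<Lambda>"
    and "\<And>k. k \<in> insert \<rho> \<Lambda> \<Longrightarrow> W {n, k} = 0"
  shows "pdens (insert n \<Lambda>) \<rho> W u s = 0"
proof -
  have "conductance \<rho> W u {n, k} = 0" if "k \<in> insert \<rho> \<Lambda>" for k
    using assms(4)[OF that] by (simp add: conductance_def)
  then have "set_det (insert n \<Lambda>) (lap (insert n \<Lambda>) \<rho> (conductance \<rho> W u)) = 0"
    using assms by (intro set_det_lap_isolated) auto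
  moreover have "\<rho> \<notin> insert n \<Lambda>" using assms by auto
  ultimately show ?thesis by (simp add: pdens_def set_det_D_mat)
qed

section \<open>Measurability of the density\<close>

lemma borel_measurable_pin:
  assumes "i \<noteq> \<rho> \<Longrightarrow> (\<lambda>\<omega>. u \<omega> i) \<in> borel_measurable M"
  shows "(\<lambda>\<omega>. pin \<rho> (u \<omega>) i) \<in> borel_measurable M"
  using assms by (cases "i = \<rho>") (auto simp: pin_def)

lemma borel_measurable_B_pair:
  assumes "\<And>k. k \<in> {i, j} - {\<rho>} \<Longrightarrow> (\<lambda>\<omega>. u \<omega> k) \<in> borel_measurable M"
    and "\<And>k. k \<in> {i, j} - {\<rho>} \<Longrightarrow> (\<lambda>\<omega>. s \<omega> k) \<in> borel_measurable M"
  shows "(\<lambda>\<omega>. B_pair \<rho> (u \<omega>) (s \<omega>) i j) \<in> borel_measurable M"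
proof -
  have [measurable]: "(\<lambda>\<omega>. pin \<rho> (u \<omega>) k) \<in> borel_measurable M"
    "(\<lambda>\<omega>. pin \<rho> (s \<omega>) k) \<in> borel_measurable M" if "k \<in> {i, j}" for k
    using that assms by (auto intro!: borel_measurable_pin)
  show ?thesis unfolding B_pair_def cosh_def by measurable
qed

text \<open>The weights may depend on \<open>\<omega>\<close> too: after an elimination they are
  functions of the integration variable \<open>t\<close>.\<close>

lemma borel_measurable_pdens:
  assumes fin: "finite \<Lambda>" and u: "\<And>i. i \<in> \<Lambda> \<Longrightarrow> (\<lambda>\<omega>. u \<omega> i) \<in> borel_measurable M"
    and s: "\<And>i. i \<in> \<Lambda> \<Longrightarrow> (\<lambda>\<omega>. s \<omega> i) \<in> borel_measurable M"
    and W: "\<And>e. (\<lambda>\<omega>. W \<omega> e) \<in> borel_measurable M"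
  shows "(\<lambda>\<omega>. pdens \<Lambda> \<rho> (W \<omega>) (u \<omega>) (s \<omega>)) \<in> borel_measurable M"
proof -
  have p: "(\<lambda>\<omega>. pin \<rho> (u \<omega>) i) \<in> borel_measurable M" if "i \<in> insert \<rho> \<Lambda>" for i
    using that u by (auto intro!: borel_measurable_pin)
  have B: "(\<lambda>\<omega>. B_pair \<rho> (u \<omega>) (s \<omega>) i j) \<in> borel_measurable M"
    if "i \<in> insert \<rho> \<Lambda>" "j \<in> insert \<rho> \<Lambda>" for i j
    using that u s by (intro borel_measurable_B_pair) auto
  have D: "(\<lambda>\<omega>. D_mat \<Lambda> \<rho> (W \<omega>) (u \<omega>) i j) \<in> borel_measurable M" if "i \<in> \<Lambda>" "j \<in> \<Lambda>" for i j
    unfolding D_mat_def using that p W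
    by (cases "i = j")
       (auto intro!: borel_measurable_sum borel_measurable_times borel_measurable_add
          borel_measurable_uminus borel_measurable_exp[THEN measurable_compose_rev])
  have det: "(\<lambda>\<omega>. set_det \<Lambda> (D_mat \<Lambda> \<rho> (W \<omega>) (u \<omega>))) \<in> borel_measurable M"
    unfolding set_det_def using D
    by (auto intro!: borel_measurable_sum borel_measurable_times borel_measurable_prod simp: permutes_in_image)
  have en: "(\<lambda>\<omega>. energy \<rho> (insert \<rho> \<Lambda>) (W \<omega>) (u \<omega>) (s \<omega>)) \<in> borel_measurable M"
    unfolding energy_def using W B
    by (intro borel_measurable_divide borel_measurable_sum borel_measurable_times borel_measurable_diff borel_measurable_const) auto
  have pr: "(\<lambda>\<omega>. \<Prod>i\<in>\<Lambda>. exp (- u \<omega> i) / (2 * pi)) \<in> borel_measurable M"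
  proof (rule borel_measurable_prod)
    fix i assume "i \<in> \<Lambda>"
    note u[OF this, measurable]
    show "(\<lambda>\<omega>. exp (- u \<omega> i) / (2 * pi)) \<in> borel_measurable M" by measurable
  qed
  note [measurable] = det en pr
  show ?thesis unfolding pdens_def by measurable
qed

section \<open>Total mass\<close>

lemma nn_integral_gaussian:
  assumes "C > 0" "K \<ge> 0"
  shows "(\<integral>\<^sup>+x. ennreal (K * exp (- (C * (x - m)\<^sup>2 / 2))) \<partial>lborel) = ennreal (K * sqrt (2 * pi / C))"
proof -
  let ?s = "1 / sqrt C"
  have s: "?s > 0" using assms by simp
  interpret prob_space "density lborel (normal_density m ?s)"
    using s by (rule prob_space_normal_density)
  have one: "(\<integral>\<^sup>+x. ennreal (normal_density m ?s x) \<partial>lborel) = 1"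
    using emeasure_space_1 by (simp add: emeasure_density)
  have nd: "K * exp (- (C * (x - m)\<^sup>2 / 2)) = K * sqrt (2 * pi / C) * normal_density m ?s x" for x
    using assms by (simp add: normal_density_def power_divide real_sqrt_divide)
  have "(\<integral>\<^sup>+x. ennreal (K * exp (- (C * (x - m)\<^sup>2 / 2))) \<partial>lborel)
      = (\<integral>\<^sup>+x. ennreal (K * sqrt (2 * pi / C)) * ennreal (normal_density m ?s x) \<partial>lborel)"
    unfolding nd using assms by (subst ennreal_mult) auto
  also have "\<dots> = ennreal (K * sqrt (2 * pi / C))"
    by (subst nn_integral_cmult) (auto simp: one)
  finally show ?thesis .
qed

text \<open>The substitution \<open>v = 2 * sinh (r / 2)\<close>, with derivative
  \<open>cosh (r / 2)\<close>, produces the centered normal density of variance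
  \<open>1 / S\<close>. It is made on the intervals from \<open>- k\<close> to \<open>k\<close>, and
  monotone convergence gives the whole line.\<close>

lemma nn_integral_sinh_gaussian:
  assumes "S > 0"
  shows "(\<integral>\<^sup>+r. ennreal (sqrt S / sqrt (2 * pi) * cosh (r / 2) * exp (- (2 * S * (sinh (r / 2))\<^sup>2))) \<partial>lborel) \<le> 1"
    (is "(\<integral>\<^sup>+r. ennreal (?f r) \<partial>lborel) \<le> 1")
proof -
  let ?g = "\<lambda>r::real. 2 * sinh (r / 2)"
  let ?h = "\<lambda>v. sqrt S / sqrt (2 * pi) * exp (- (S * (v - 0)\<^sup>2 / 2))"
  have le: "(\<integral>\<^sup>+r. ennreal (?f r) * indicator {- real k .. real k} r \<partial>lborel) \<le> 1" for k
  proof -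
    have "(\<integral>\<^sup>+r. ennreal (?f r) * indicator {- real k .. real k} r \<partial>lborel)
        = (\<integral>\<^sup>+r. ennreal (?h (?g r) * cosh (r / 2) * indicator {- real k .. real k} r) \<partial>lborel)"
      by (intro nn_integral_cong) (auto simp: power_mult_distrib mult_ac split: split_indicator)
    also have "\<dots> = (\<integral>\<^sup>+v. ennreal (?h v * indicator {?g (- real k) .. ?g (real k)} v) \<partial>lborel)"
    proof (rule nn_integral_substitution[symmetric])
      show "(?g has_real_derivative cosh (r / 2)) (at r)" for r
        by (auto intro!: derivative_eq_intros)
    qed (auto intro!: continuous_intros simp: set_borel_measurable_def)
    also have "\<dots> \<le> (\<integral>\<^sup>+v. ennreal (?h v) \<partial>lborel)"
      by (intro nn_integral_mono) (auto split: split_indicator)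
    also have "\<dots> = ennreal (sqrt S / sqrt (2 * pi) * sqrt (2 * pi / S))"
      using assms by (intro nn_integral_gaussian) auto
    also have "\<dots> = 1" using assms by (simp add: real_sqrt_divide)
    finally show ?thesis .
  qed
  have "(\<integral>\<^sup>+r. ennreal (?f r) \<partial>lborel) = (\<integral>\<^sup>+r. (SUP k. ennreal (?f r) * indicator {- real k .. real k} r) \<partial>lborel)"
  proof (intro nn_integral_cong)
    fix r :: real
    obtain k :: nat where "\<bar>r\<bar> \<le> real k" using real_arch_simple by blast
    then have "ennreal (?f r) \<le> (SUP k. ennreal (?f r) * indicator {- real k .. real k} r)"
      by (intro SUP_upper2[of k]) (auto split: split_indicator)
    moreover have "(SUP k. ennreal (?f r) * indicator {- real k .. real k} r) \<le> ennreal (?f r)"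
      by (intro SUP_least) (auto split: split_indicator)
    ultimately show "ennreal (?f r) = (SUP k. ennreal (?f r) * indicator {- real k .. real k} r)"
      by (rule antisym)
  qed
  also have "\<dots> = (SUP k. \<integral>\<^sup>+r. ennreal (?f r) * indicator {- real k .. real k} r \<partial>lborel)"
  proof (rule nn_integral_monotone_convergence_SUP)
    show "incseq (\<lambda>k r. ennreal (?f r) * indicator {- real k .. real k} r)"
      by (auto simp: incseq_def le_fun_def split: split_indicator)
    have [measurable]: "(cosh :: real \<Rightarrow> real) \<in> borel_measurable borel" "(sinh :: real \<Rightarrow> real) \<in> borel_measurable borel"
      by (auto intro!: borel_measurable_continuous_onI continuous_intros)
    show "(\<lambda>r. ennreal (?f r) * indicator {- real k .. real k} r) \<in> borel_measurable lborel" for k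
      by measurable
  qed
  also have "\<dots> \<le> 1" using le by (rule SUP_least)
  finally show ?thesis .
qed

text \<open>With \<open>y = exp (- t)\<close>, this is the reciprocal inverse Gaussian density
  \<open>exp (- ((y - S)\<^sup>2 / (2 * y))) / sqrt (2 * pi * y)\<close> in the variable
  \<open>t\<close>; the Jacobian \<open>y\<close> turns \<open>1 / sqrt y\<close> into
  \<open>sqrt y\<close>.\<close>

definition elim_kernel :: "real \<Rightarrow> real \<Rightarrow> real" where
  "elim_kernel S t = sqrt (exp (- t)) / sqrt (2 * pi) * exp (- ((exp (- t) - S)\<^sup>2 / (2 * exp (- t))))"

lemma borel_measurable_elim_kernel [measurable]: "elim_kernel S \<in> borel_measurable borel"
  unfolding elim_kernel_def by measurable

text \<open>After centering at \<open>exp (- t) = S\<close>, averaging over \<open>r\<close> and \<open>- r\<close> turns the factor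
  \<open>exp (- r / 2)\<close> into \<open>cosh (r / 2)\<close>, the derivative of \<open>2 * sinh (r / 2)\<close>.\<close>
lemma nn_integral_elim_kernel:
  assumes "S > 0"
  shows "(\<integral>\<^sup>+t. ennreal (elim_kernel S t) \<partial>lborel) \<le> 1"
proof -
  let ?k = "\<lambda>r. elim_kernel S (- ln S + r)" and ?G = "\<lambda>r::real. exp (- (2 * S * (sinh (r / 2))\<^sup>2))"
  let ?c = "sqrt S / sqrt (2 * pi)"
  have k: "?k r = ?c * exp (- r / 2) * ?G r" for r
  proof -
    have y: "exp (- (- ln S + r)) = S * exp (- r)" using assms by (simp add: exp_diff exp_minus field_simps)
    have sq: "sqrt (exp (- r)) = exp (- r / 2)"
      by (rule real_sqrt_unique) (simp_all add: power2_eq_square exp_add[symmetric])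
    have "(S * exp (- r) - S)\<^sup>2 / (2 * (S * exp (- r))) = S * ((exp (- r) - 1)\<^sup>2 * exp r) / 2"
      using assms by (simp add: power2_eq_square field_simps exp_minus)
    also have "(exp (- r) - 1)\<^sup>2 * exp r = ((exp (- r) - 1) * exp (r / 2))\<^sup>2"
      by (simp add: power_mult_distrib power2_eq_square[of "exp (r / 2)"] exp_add[symmetric])
    also have "(exp (- r) - 1) * exp (r / 2) = exp (- r / 2) - exp (r / 2)"
      by (simp add: algebra_simps exp_add[symmetric])
    also have "\<dots> = - 2 * sinh (r / 2)" by (simp add: sinh_def)
    finally have "(S * exp (- r) - S)\<^sup>2 / (2 * (S * exp (- r))) = 2 * S * (sinh (r / 2))\<^sup>2"
      by (simp add: power_mult_distrib)
    then show ?thesis unfolding elim_kernel_def y by (simp add: real_sqrt_mult sq)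
  qed
  have [measurable]: "(cosh :: real \<Rightarrow> real) \<in> borel_measurable borel" "(sinh :: real \<Rightarrow> real) \<in> borel_measurable borel"
    by (auto intro!: borel_measurable_continuous_onI continuous_intros)
  let ?I = "\<integral>\<^sup>+t. ennreal (elim_kernel S t) \<partial>lborel"
  have I1: "?I = (\<integral>\<^sup>+r. ennreal (?c * exp (- r / 2) * ?G r) \<partial>lborel)"
    unfolding k[symmetric] by (subst nn_integral_real_affine[where c=1 and t="- ln S"]) simp_all
  have I2: "?I = (\<integral>\<^sup>+r. ennreal (?c * exp (r / 2) * ?G r) \<partial>lborel)"
    unfolding I1 by (subst nn_integral_real_affine[where c="-1" and t=0]) simp_all
  have "?I + ?I = (\<integral>\<^sup>+r. ennreal (?c * exp (- r / 2) * ?G r) \<partial>lborel)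
      + (\<integral>\<^sup>+r. ennreal (?c * exp (r / 2) * ?G r) \<partial>lborel)"
    by (rule arg_cong2[of _ _ _ _ "(+)", OF I1 I2])
  also have "\<dots> = (\<integral>\<^sup>+r. ennreal (?c * exp (- r / 2) * ?G r) + ennreal (?c * exp (r / 2) * ?G r) \<partial>lborel)"
    by (subst nn_integral_add) simp_all
  also have "\<dots> = (\<integral>\<^sup>+r. 2 * ennreal (?c * cosh (r / 2) * ?G r) \<partial>lborel)"
  proof (intro nn_integral_cong)
    fix r :: real
    have "ennreal (?c * exp (- r / 2) * ?G r) + ennreal (?c * exp (r / 2) * ?G r)
        = ennreal (?c * exp (- r / 2) * ?G r + ?c * exp (r / 2) * ?G r)"
      using assms by (simp add: ennreal_plus)
    also have "?c * exp (- r / 2) * ?G r + ?c * exp (r / 2) * ?G r = 2 * (?c * cosh (r / 2) * ?G r)"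
      by (simp add: cosh_def field_simps)
    also have "ennreal \<dots> = 2 * ennreal (?c * cosh (r / 2) * ?G r)"
      using assms by (subst ennreal_mult) simp_all
    finally show "ennreal (?c * exp (- r / 2) * ?G r) + ennreal (?c * exp (r / 2) * ?G r)
        = 2 * ennreal (?c * cosh (r / 2) * ?G r)" .
  qed
  also have "\<dots> = 2 * (\<integral>\<^sup>+r. ennreal (?c * cosh (r / 2) * ?G r) \<partial>lborel)"
    by (subst nn_integral_cmult) simp_all
  also have "\<dots> \<le> 2 * 1"
    by (intro mult_left_mono nn_integral_sinh_gaussian assms) simp
  finally have "2 * ?I \<le> 2 * 1" by (simp add: mult_2)
  then show ?thesis by (subst (asm) ennreal_mult_le_mult_iff) simp_all
qed

section \<open>Integration over all fields\<close>

abbreviation lborel_Pi :: "'a set \<Rightarrow> ('a \<Rightarrow> real) measure" where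
  "lborel_Pi \<Lambda> \<equiv> PiM \<Lambda> (\<lambda>_. lborel)"

lemma product_sigma_finite_lborel: "product_sigma_finite (\<lambda>_::'a. lborel :: real measure)"
  by unfold_locales

lemma sigma_finite_lborel_Pi: "finite \<Lambda> \<Longrightarrow> sigma_finite_measure (lborel_Pi \<Lambda>)"
  by (rule product_sigma_finite.sigma_finite[OF product_sigma_finite_lborel])

lemma borel_measurable_lborel_Pi_component:
  "i \<in> \<Lambda> \<Longrightarrow> (\<lambda>u. u i) \<in> borel_measurable (lborel_Pi \<Lambda>)"
  using measurable_component_singleton[of i \<Lambda> "\<lambda>_. lborel :: real measure"] by simp

text \<open>Integrating out \<open>\<sigma>\<close> gives \<open>sqrt (2 * pi / C)\<close>, and
  \<open>sqrt C = sqrt y * exp x\<close> cancels the remaining \<open>exp x\<close>. The result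
  depends on \<open>t\<close> and \<open>S\<close> only, hence not on the fields at the other
  vertices.\<close>

lemma elim_kernel_eq:
  assumes "y = exp (- t)" "C = y * exp (2 * x)"
  shows "exp (- ((y - S)\<^sup>2 / (2 * y))) * (y * exp x / (2 * pi)) * sqrt (2 * pi / C) = elim_kernel S t"
proof -
  have y: "y > 0" using assms by simp
  have "sqrt C = sqrt y * exp x"
    using exp_add[of x x] by (simp add: assms(2) real_sqrt_mult)
  then have "y * exp x / (2 * pi) * sqrt (2 * pi / C) = (y / sqrt y) * (sqrt (2 * pi) / (2 * pi))"
    by (simp add: real_sqrt_divide)
  also have "\<dots> = sqrt y / sqrt (2 * pi)"
    using y real_div_sqrt[of y] real_div_sqrt[of "2 * pi"] by (simp add: field_simps)
  finally show ?thesis unfolding elim_kernel_def assms(1)[symmetric] mult.assoc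
    by (simp only: mult.commute)
qed

lemma elim_kernel_nonneg: "0 \<le> elim_kernel S t"
  by (simp add: elim_kernel_def)

text \<open>For fixed \<open>u\<close> on \<open>\<Lambda>\<close> the variable \<open>x = u n\<close> is shifted by \<open>ln A\<close>. Afterwards
  \<open>exp (- t) = (\<Sum>j. W {n, j} * exp (u j - x))\<close>, and the reduced weights depend on \<open>t\<close> only.\<close>
lemma nn_integral_pdens_insert:
  fixes \<Lambda> :: "'a set"
  assumes fin: "finite \<Lambda>" and n: "n \<notin> insert \<rho> \<Lambda>" and \<rho>: "\<rho> \<notin> \<Lambda>"
    and W: "\<And>e. e \<in> edges (insert n (insert \<rho> \<Lambda>)) \<Longrightarrow> 0 \<le> W e"
    and S: "S = (\<Sum>j\<in>insert \<rho> \<Lambda>. W {n, j})" "S > 0"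
  shows "(\<integral>\<^sup>+x. \<integral>\<^sup>+s. ennreal (pdens (insert n \<Lambda>) \<rho> W (u(n := x)) s) \<partial>lborel_Pi (insert n \<Lambda>) \<partial>lborel)
       = (\<integral>\<^sup>+t. ennreal (elim_kernel S t)
            * (\<integral>\<^sup>+s. ennreal (pdens \<Lambda> \<rho> (star_mesh n W (exp (- t))) u s) \<partial>lborel_Pi \<Lambda>) \<partial>lborel)"
proof -
  interpret product_sigma_finite "\<lambda>_::'a. lborel :: real measure" by (rule product_sigma_finite_lborel)
  interpret P': sigma_finite_measure "lborel_Pi (insert n \<Lambda>)" using fin by (intro sigma_finite_lborel_Pi) simp
  let ?V = "insert \<rho> \<Lambda>"
  define A where "A = (\<Sum>j\<in>?V. W {n, j} * exp (pin \<rho> u j))"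
  have Wn: "0 \<le> W {n, j}" if "j \<in> ?V" for j
    using that n by (intro W doubleton_edges) auto
  have A0: "A > 0"
  proof -
    obtain j where j: "j \<in> ?V" "W {n, j} \<noteq> 0"
      using S sum.neutral[of ?V "\<lambda>j. W {n, j}"] by fastforce
    then have "0 < W {n, j} * exp (pin \<rho> u j)" using Wn[of j] by simp
    then show ?thesis unfolding A_def using j fin Wn by (intro sum_pos2[of _ j]) auto
  qed
  let ?F = "\<lambda>x s. ennreal (pdens (insert n \<Lambda>) \<rho> W (u(n := x)) s)"
  have meas: "(\<lambda>(x, s). ?F x s) \<in> borel_measurable (lborel \<Otimes>\<^sub>M lborel_Pi (insert n \<Lambda>))"
  proof -
    have "(\<lambda>\<omega>. pdens (insert n \<Lambda>) \<rho> W (u(n := fst \<omega>)) (snd \<omega>)) \<in> borel_measurable (lborel \<Otimes>\<^sub>M lborel_Pi (insert n \<Lambda>))"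
    proof (rule borel_measurable_pdens)
      show "(\<lambda>\<omega>. (u(n := fst \<omega>)) i) \<in> borel_measurable (lborel \<Otimes>\<^sub>M lborel_Pi (insert n \<Lambda>))" for i
        by (cases "i = n") auto
      show "(\<lambda>\<omega>. snd \<omega> i) \<in> borel_measurable (lborel \<Otimes>\<^sub>M lborel_Pi (insert n \<Lambda>))" if "i \<in> insert n \<Lambda>" for i
        using borel_measurable_lborel_Pi_component[OF that] by (rule measurable_compose[OF measurable_snd])
    qed (use fin in auto)
    then show ?thesis by (simp add: case_prod_beta')
  qed
  have "(\<integral>\<^sup>+x. \<integral>\<^sup>+s. ?F x s \<partial>lborel_Pi (insert n \<Lambda>) \<partial>lborel)
      = (\<integral>\<^sup>+t. \<integral>\<^sup>+s. ?F (ln A + t) s \<partial>lborel_Pi (insert n \<Lambda>) \<partial>lborel)"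
    using P'.borel_measurable_nn_integral[OF meas]
    by (subst nn_integral_real_affine[where c = 1 and t = "ln A"]) simp_all
  also have "\<dots> = (\<integral>\<^sup>+t. ennreal (elim_kernel S t)
            * (\<integral>\<^sup>+s. ennreal (pdens \<Lambda> \<rho> (star_mesh n W (exp (- t))) u s) \<partial>lborel_Pi \<Lambda>) \<partial>lborel)"
  proof (rule nn_integral_cong)
    fix t :: real
    define x where "x = ln A + t"
    define y where "y = exp (- t)"
    define C where "C = y * exp (2 * x)"
    define m where "m s = (\<Sum>j\<in>?V. W {n, j} * exp (x + pin \<rho> u j) * pin \<rho> s j) / C" for s
    define K where "K = exp (- ((y - S)\<^sup>2 / (2 * y))) * (y * exp x / (2 * pi))"
    let ?p = "\<lambda>s. pdens \<Lambda> \<rho> (star_mesh n W y) u s"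
    have y0: "y > 0" and C0: "C > 0" and K0: "K \<ge> 0" by (auto simp: y_def C_def K_def)
    have p0: "0 \<le> ?p s" for s
      using fin \<rho> n y0 W by (intro pdens_nonneg star_mesh_nonneg[where V="?V" and n=n]) auto
    have meas_s: "?F x \<in> borel_measurable (lborel_Pi (insert n \<Lambda>))"
      using measurable_compose[OF measurable_Pair1' meas, of x] by simp
    have meas_p: "(\<lambda>s. ennreal (?p s)) \<in> borel_measurable (lborel_Pi \<Lambda>)"
      by (intro measurable_compose[OF borel_measurable_pdens measurable_ennreal] fin
          borel_measurable_lborel_Pi_component) auto
    have "(\<integral>\<^sup>+s. ?F x s \<partial>lborel_Pi (insert n \<Lambda>)) = (\<integral>\<^sup>+s. \<integral>\<^sup>+\<sigma>. ?F x (s(n := \<sigma>)) \<partial>lborel \<partial>lborel_Pi \<Lambda>)"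
      using n by (intro product_nn_integral_insert meas_s fin) auto
    also have "\<dots> = (\<integral>\<^sup>+s. ennreal (elim_kernel S t) * ennreal (?p s) \<partial>lborel_Pi \<Lambda>)"
    proof (rule nn_integral_cong)
      fix s :: "'a \<Rightarrow> real"
      have "(\<integral>\<^sup>+\<sigma>. ?F x (s(n := \<sigma>)) \<partial>lborel)
          = (\<integral>\<^sup>+\<sigma>. ennreal (?p s * K * exp (- (C * (\<sigma> - m s)\<^sup>2 / 2))) \<partial>lborel)"
        unfolding K_def
        by (simp add: pdens_insert[OF fin n \<rho> A_def A0 x_def y_def S(1) C_def m_def] mult.assoc)
      also have "\<dots> = ennreal (?p s * K * sqrt (2 * pi / C))"
        using C0 p0 K0 by (intro nn_integral_gaussian) auto
      also have "?p s * K * sqrt (2 * pi / C) = elim_kernel S t * ?p s"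
        unfolding mult.assoc elim_kernel_eq[OF y_def C_def, of S, folded K_def] by (rule mult.commute)
      also have "ennreal \<dots> = ennreal (elim_kernel S t) * ennreal (?p s)"
        using p0 elim_kernel_nonneg by (intro ennreal_mult) auto
      finally show "(\<integral>\<^sup>+\<sigma>. ?F x (s(n := \<sigma>)) \<partial>lborel) = ennreal (elim_kernel S t) * ennreal (?p s)" .
    qed
    also have "\<dots> = ennreal (elim_kernel S t) * (\<integral>\<^sup>+s. ennreal (?p s) \<partial>lborel_Pi \<Lambda>)"
      by (intro nn_integral_cmult meas_p)
    finally show "(\<integral>\<^sup>+s. ?F (ln A + t) s \<partial>lborel_Pi (insert n \<Lambda>)) = ennreal (elim_kernel S t)
        * (\<integral>\<^sup>+s. ennreal (pdens \<Lambda> \<rho> (star_mesh n W (exp (- t))) u s) \<partial>lborel_Pi \<Lambda>)"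
      unfolding x_def y_def .
  qed
  finally show ?thesis .
qed

text \<open>Induction on the vertices, for all weights at once because the reduced weights vary with
  \<open>t\<close>. A vertex without positive weights makes the density vanish. Otherwise it is
  eliminated, and both the reduced model and the kernel in \<open>t\<close> have mass at most
  1.\<close>

lemma nn_integral_pdens_le_1:
  fixes \<Lambda> :: "'a set"
  assumes "finite \<Lambda>" "\<rho> \<notin> \<Lambda>" "\<And>e. e \<in> edges (insert \<rho> \<Lambda>) \<Longrightarrow> 0 \<le> W e"
  shows "(\<integral>\<^sup>+u. \<integral>\<^sup>+s. ennreal (pdens \<Lambda> \<rho> W u s) \<partial>lborel_Pi \<Lambda> \<partial>lborel_Pi \<Lambda>) \<le> 1"
  using assms
proof (induction \<Lambda> arbitrary: W rule: finite_induct)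
  case empty
  interpret product_sigma_finite "\<lambda>_::'a. lborel :: real measure" by (rule product_sigma_finite_lborel)
  have "pdens {} \<rho> W u s = 1" for u s
    by (simp add: pdens_def energy_def)
  then show ?case by (simp add: PiM_empty)
next
  case (insert n \<Lambda>)
  interpret product_sigma_finite "\<lambda>_::'a. lborel :: real measure" by (rule product_sigma_finite_lborel)
  interpret P: sigma_finite_measure "lborel_Pi \<Lambda>" using insert.hyps by (intro sigma_finite_lborel_Pi)
  interpret P': sigma_finite_measure "lborel_Pi (insert n \<Lambda>)" using insert.hyps by (intro sigma_finite_lborel_Pi) simp
  interpret PL: pair_sigma_finite "lborel :: real measure" "lborel_Pi \<Lambda>" ..
  let ?V = "insert \<rho> \<Lambda>"
  note fin = insert.hyps(1)
  have ins: "insert \<rho> (insert n \<Lambda>) = insert n ?V" by auto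
  have n: "n \<notin> ?V" and \<rho>: "\<rho> \<notin> \<Lambda>" using insert by auto
  have W: "0 \<le> W e" if "e \<in> edges (insert n ?V)" for e
    using insert.prems(2)[unfolded ins] that .
  have Wn: "0 \<le> W {n, j}" if "j \<in> ?V" for j
    using that n by (intro W doubleton_edges) auto
  define S where "S = (\<Sum>j\<in>?V. W {n, j})"
  have S0: "0 \<le> S" unfolding S_def using Wn by (rule sum_nonneg)
  show ?case
  proof (cases "S = 0")
    case True
    have "W {n, j} = 0" if "j \<in> ?V" for j
      using True that fin Wn unfolding S_def by (subst (asm) sum_nonneg_eq_0_iff) auto
    then have "pdens (insert n \<Lambda>) \<rho> W u s = 0" for u s
      by (intro pdens_isolated fin n \<rho>)
    then show ?thesis by simp
  next
    case False
    then have Spos: "S > 0" using S0 by simp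
    let ?F = "\<lambda>u s. ennreal (pdens (insert n \<Lambda>) \<rho> W u s)"
    let ?G = "\<lambda>t u. \<integral>\<^sup>+s. ennreal (pdens \<Lambda> \<rho> (star_mesh n W (exp (- t))) u s) \<partial>lborel_Pi \<Lambda>"
    have measF: "(\<lambda>u. \<integral>\<^sup>+s. ?F u s \<partial>lborel_Pi (insert n \<Lambda>)) \<in> borel_measurable (lborel_Pi (insert n \<Lambda>))"
    proof (rule P'.borel_measurable_nn_integral)
      let ?M = "lborel_Pi (insert n \<Lambda>) \<Otimes>\<^sub>M lborel_Pi (insert n \<Lambda>)"
      have "(\<lambda>\<omega>. pdens (insert n \<Lambda>) \<rho> W (fst \<omega>) (snd \<omega>)) \<in> borel_measurable ?M"
        using fin by (intro borel_measurable_pdens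
            measurable_compose[OF measurable_fst borel_measurable_lborel_Pi_component]
            measurable_compose[OF measurable_snd borel_measurable_lborel_Pi_component]) auto
      then show "(\<lambda>(u, s). ?F u s) \<in> borel_measurable ?M" by (simp add: case_prod_beta')
    qed
    have measG: "(\<lambda>(t, u). ?G t u) \<in> borel_measurable (lborel \<Otimes>\<^sub>M lborel_Pi \<Lambda>)"
    proof -
      let ?M = "(lborel \<Otimes>\<^sub>M lborel_Pi \<Lambda>) \<Otimes>\<^sub>M lborel_Pi \<Lambda>"
      have c: "(\<lambda>\<omega>. snd (fst \<omega>) i) \<in> borel_measurable ?M" if "i \<in> \<Lambda>" for i
        by (rule measurable_compose[OF measurable_fst
              measurable_compose[OF measurable_snd borel_measurable_lborel_Pi_component[OF that]]])
      have "(\<lambda>\<omega>. pdens \<Lambda> \<rho> (star_mesh n W (exp (- fst (fst \<omega>)))) (snd (fst \<omega>)) (snd \<omega>)) \<in> borel_measurable ?M"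
        using fin
      proof (rule borel_measurable_pdens)
        show "(\<lambda>\<omega>. snd \<omega> i) \<in> borel_measurable ?M" if "i \<in> \<Lambda>" for i
          by (rule measurable_compose[OF measurable_snd borel_measurable_lborel_Pi_component[OF that]])
        show "(\<lambda>\<omega>. star_mesh n W (exp (- fst (fst \<omega>))) e) \<in> borel_measurable ?M" for e
          unfolding star_mesh_def by measurable
      qed (rule c)
      then have "(\<lambda>(\<omega>, s). ennreal (pdens \<Lambda> \<rho> (star_mesh n W (exp (- fst \<omega>))) (snd \<omega>) s)) \<in> borel_measurable ?M"
        by (simp add: case_prod_beta')
      from P.borel_measurable_nn_integral[OF this] show ?thesis by (simp add: case_prod_beta')
    qed
    have measG': "?G t \<in> borel_measurable (lborel_Pi \<Lambda>)" for t
      using measurable_compose[OF measurable_Pair1' measG, of t] by simp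
    have IH: "(\<integral>\<^sup>+u. ?G t u \<partial>lborel_Pi \<Lambda>) \<le> 1" for t
      using W n by (intro insert.IH \<rho> star_mesh_nonneg[where V="?V" and n=n]) auto
    have "(\<integral>\<^sup>+u. \<integral>\<^sup>+s. ?F u s \<partial>lborel_Pi (insert n \<Lambda>) \<partial>lborel_Pi (insert n \<Lambda>))
        = (\<integral>\<^sup>+u. \<integral>\<^sup>+x. \<integral>\<^sup>+s. ?F (u(n := x)) s \<partial>lborel_Pi (insert n \<Lambda>) \<partial>lborel \<partial>lborel_Pi \<Lambda>)"
      using insert.hyps by (intro product_nn_integral_insert measF) auto
    also have "\<dots> = (\<integral>\<^sup>+u. \<integral>\<^sup>+t. ennreal (elim_kernel S t) * ?G t u \<partial>lborel \<partial>lborel_Pi \<Lambda>)"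
      using W by (simp only: nn_integral_pdens_insert[OF fin n \<rho> _ S_def Spos])
    \<comment> \<open>With \<open>t\<close> integrated last, the reduced weights are fixed inside
      the integral over \<open>u\<close>, so that the induction hypothesis applies.\<close>
    also have "\<dots> = (\<integral>\<^sup>+t. \<integral>\<^sup>+u. ennreal (elim_kernel S t) * ?G t u \<partial>lborel_Pi \<Lambda> \<partial>lborel)"
    proof (rule PL.Fubini')
      have "(\<lambda>\<omega>. ennreal (elim_kernel S (fst \<omega>)) * (case \<omega> of (t, u) \<Rightarrow> ?G t u)) \<in> borel_measurable (lborel \<Otimes>\<^sub>M lborel_Pi \<Lambda>)"
        using measG by measurable
      then show "(\<lambda>(t, u). ennreal (elim_kernel S t) * ?G t u) \<in> borel_measurable (lborel \<Otimes>\<^sub>M lborel_Pi \<Lambda>)"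
        by (simp add: case_prod_beta')
    qed
    also have "\<dots> = (\<integral>\<^sup>+t. ennreal (elim_kernel S t) * (\<integral>\<^sup>+u. ?G t u \<partial>lborel_Pi \<Lambda>) \<partial>lborel)"
      by (intro nn_integral_cong nn_integral_cmult measG')
    also have "\<dots> \<le> (\<integral>\<^sup>+t. ennreal (elim_kernel S t) * 1 \<partial>lborel)"
      by (intro nn_integral_mono mult_left_mono IH) simp
    also have "\<dots> \<le> 1" using nn_integral_elim_kernel[OF Spos] by simp
    finally show ?thesis .
  qed
qed

section \<open>Hyperbolic distances\<close>

lemma le_sinh:
  assumes "0 \<le> (x::real)"
  shows "x \<le> sinh x"
proof -
  have "sinh 0 - 0 \<le> sinh x - x"
    using assms
  proof (rule DERIV_nonneg_imp_nondecreasing)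
    show "\<exists>d. ((\<lambda>x. sinh x - x) has_real_derivative d) (at y) \<and> d \<ge> 0" for y :: real
      by (intro exI[of _ "cosh y - 1"]) (auto intro!: derivative_eq_intros simp: cosh_real_ge_1)
  qed
  then show ?thesis by simp
qed

lemma sq_le_cosh: "(t::real)\<^sup>2 / 2 \<le> cosh t - 1"
proof -
  have "t\<^sup>2 / 2 \<le> cosh t - 1" if "0 \<le> t" for t :: real
  proof -
    have "cosh 0 - 0\<^sup>2 / 2 \<le> cosh t - t\<^sup>2 / 2"
      using that
    proof (rule DERIV_nonneg_imp_nondecreasing)
      fix y :: real assume "0 \<le> y"
      then show "\<exists>d. ((\<lambda>t. cosh t - t\<^sup>2 / 2) has_real_derivative d) (at y) \<and> d \<ge> 0"
        by (intro exI[of _ "sinh y - y"]) (auto intro!: derivative_eq_intros simp: le_sinh)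
    qed
    then show ?thesis by simp
  qed
  from this[of "\<bar>t\<bar>"] show ?thesis by (cases "t \<ge> 0") auto
qed

text \<open>For \<open>t \<ge> 0\<close> the function \<open>ln (cosh t) - t\<^sup>2 / 2\<close> is
  nonincreasing, as its derivative \<open>sinh t / cosh t - t\<close> is at most 0. Negative
  arguments follow because both sides are even.\<close>

lemma cosh_le_exp_sq: "cosh (t::real) \<le> exp (t\<^sup>2 / 2)"
proof -
  have "cosh t \<le> exp (t\<^sup>2 / 2)" if "0 \<le> t" for t :: real
  proof -
    let ?f = "\<lambda>t::real. ln (cosh t) - t\<^sup>2 / 2"
    have le: "sinh x \<le> x * cosh x" if "0 \<le> x" for x :: real
    proof -
      have "sinh 0 - 0 * cosh 0 \<ge> sinh x - x * cosh x"
        using that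
      proof (rule DERIV_nonpos_imp_nonincreasing[of 0 x "\<lambda>x. sinh x - x * cosh x"])
        fix y :: real assume "0 \<le> y" "y \<le> x"
        then have "((\<lambda>x. sinh x - x * cosh x) has_real_derivative - (y * sinh y)) (at y)" "- (y * sinh y) \<le> 0"
          by (auto intro!: derivative_eq_intros)
        then show "\<exists>z. ((\<lambda>x. sinh x - x * cosh x) has_real_derivative z) (at y) \<and> z \<le> 0" by blast
      qed
      then show ?thesis by simp
    qed
    have "?f t \<le> ?f 0" using that
    proof (rule DERIV_nonpos_imp_nonincreasing)
      fix x :: real assume "0 \<le> x" "x \<le> t"
      have "cosh x > 0" by (rule cosh_real_pos)
      then have "(?f has_real_derivative sinh x / cosh x - x) (at x)"
        by (auto intro!: derivative_eq_intros simp: field_simps)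
      moreover have "sinh x / cosh x - x \<le> 0"
        using le[OF \<open>0 \<le> x\<close>] \<open>cosh x > 0\<close> by (simp add: field_simps)
      ultimately show "\<exists>y. (?f has_real_derivative y) (at x) \<and> y \<le> 0" by blast
    qed
    then have "ln (cosh t) \<le> t\<^sup>2 / 2" by simp
    then have "exp (ln (cosh t)) \<le> exp (t\<^sup>2 / 2)" by (simp only: exp_le_cancel_iff)
    then show ?thesis by (simp add: cosh_real_pos)
  qed
  from this[of "\<bar>t\<bar>"] show ?thesis by (cases "t \<ge> 0") auto
qed

lemma B_pair_ge_1: "1 \<le> B_pair \<rho> u s i j"
  unfolding B_pair_def by (simp add: cosh_real_ge_1 add_increasing2)

text \<open>\<open>B_pair\<close> is the hyperbolic cosine of the distance in the hyperbolic plane, in horospherical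
  coordinates \<open>(u, s)\<close>. With the middle point moved to the origin, the outer points lie on the
  hyperboloid \<open>z\<^sup>2 - x\<^sup>2 - y\<^sup>2 = 1\<close> and the claim is the Cauchy-Schwarz inequality for \<open>(x, y)\<close>.\<close>
lemma B_pair_triangle:
  "B_pair \<rho> u s i k \<le> B_pair \<rho> u s i j * B_pair \<rho> u s j k
     + sqrt ((B_pair \<rho> u s i j)\<^sup>2 - 1) * sqrt ((B_pair \<rho> u s j k)\<^sup>2 - 1)"
proof -
  \<comment> \<open>Translating \<open>s\<close> and then scaling by
    \<open>exp (pin \<rho> u j)\<close>, together with the shift of \<open>u\<close>, is an isometry
    that moves the point \<open>j\<close> to the origin; \<open>a\<close>, \<open>p\<close> and
    \<open>b\<close>, \<open>q\<close> are the coordinates of \<open>i\<close> and \<open>k\<close>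
    afterwards.\<close>
  define a b where "a = pin \<rho> u i - pin \<rho> u j" and "b = pin \<rho> u k - pin \<rho> u j"
  define p q where "p = (pin \<rho> s i - pin \<rho> s j) * exp (pin \<rho> u j)"
    and "q = (pin \<rho> s k - pin \<rho> s j) * exp (pin \<rho> u j)"
  define z where "z a p = cosh a + 1 / 2 * p\<^sup>2 * exp a" for a p :: real
  define x where "x a p = sinh a - 1 / 2 * p\<^sup>2 * exp a" for a p :: real
  define y where "y a p = p * exp a" for a p :: real
  have sq: "(t * exp v)\<^sup>2 * exp w = t\<^sup>2 * exp (2 * v + w)" for t v w :: real
    by (simp add: power_mult_distrib exp_add exp_double)
  have Bij: "B_pair \<rho> u s i j = z a p"
    unfolding B_pair_def z_def a_def p_def mult.assoc sq by (simp add: algebra_simps)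
  have Bjk: "B_pair \<rho> u s j k = z b q"
    unfolding B_pair_commute[of _ _ _ j] unfolding B_pair_def z_def b_def q_def mult.assoc sq
    by (simp add: algebra_simps)
  have pq: "p - q = (pin \<rho> s i - pin \<rho> s k) * exp (pin \<rho> u j)"
    by (simp add: p_def q_def algebra_simps)
  have Bik: "B_pair \<rho> u s i k = cosh (a - b) + 1 / 2 * ((p - q)\<^sup>2 * exp (a + b))"
    unfolding B_pair_def pq sq a_def b_def by (simp add: algebra_simps)
  \<comment> \<open>In the light-cone coordinates \<open>z + x\<close> and \<open>z - x\<close> the
    hyperboloid equation becomes a product.\<close>
  have hyp: "(z a p)\<^sup>2 - 1 = (x a p)\<^sup>2 + (y a p)\<^sup>2" for a p
  proof -
    have "z a p + x a p = exp a" "z a p - x a p = exp (- a) + p\<^sup>2 * exp a"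
      by (simp_all add: z_def x_def cosh_def sinh_def field_simps)
    then have "(z a p + x a p) * (z a p - x a p) = 1 + (y a p)\<^sup>2"
      by (simp add: y_def power_mult_distrib distrib_left exp_minus power2_eq_square)
    then show ?thesis by (simp add: power2_eq_square algebra_simps)
  qed
  have "z a p * z b q - x a p * x b q - y a p * y b q
      = cosh (a - b) + 1 / 2 * ((cosh a + sinh a) * (q\<^sup>2 * exp b) + (cosh b + sinh b) * (p\<^sup>2 * exp a))
        - p * q * exp a * exp b"
    by (simp add: z_def x_def y_def cosh_diff algebra_simps)
  also have "\<dots> = B_pair \<rho> u s i k"
    unfolding cosh_plus_sinh Bik by (simp add: exp_add power2_eq_square algebra_simps)
  finally have eq: "B_pair \<rho> u s i k = z a p * z b q - x a p * x b q - y a p * y b q" by simp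
  \<comment> \<open>The two sides differ by the square of
    \<open>x a p * y b q - y a p * x b q\<close>.\<close>
  have "(- x a p * x b q - y a p * y b q)\<^sup>2 \<le> ((x a p)\<^sup>2 + (y a p)\<^sup>2) * ((x b q)\<^sup>2 + (y b q)\<^sup>2)"
    using zero_le_power2[of "x a p * y b q - y a p * x b q"] by (simp add: power2_eq_square algebra_simps)
  then have "- x a p * x b q - y a p * y b q \<le> sqrt (((x a p)\<^sup>2 + (y a p)\<^sup>2) * ((x b q)\<^sup>2 + (y b q)\<^sup>2))"
    by (rule real_le_rsqrt)
  then show ?thesis
    unfolding eq Bij Bjk hyp real_sqrt_mult by simp
qed

text \<open>The bound in \<open>B_pair_triangle\<close> is the addition formula for
  \<open>cosh\<close> at the two distances, and \<open>cosh\<close> is increasing on nonnegative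
  arguments.\<close>

lemma arcosh_B_pair_triangle:
  "arcosh (B_pair \<rho> u s i k) \<le> arcosh (B_pair \<rho> u s i j) + arcosh (B_pair \<rho> u s j k)"
proof -
  let ?a = "arcosh (B_pair \<rho> u s i j)" and ?b = "arcosh (B_pair \<rho> u s j k)"
  have "B_pair \<rho> u s i k \<le> cosh (?a + ?b)"
    using B_pair_triangle[of \<rho> u s i k j]
    by (simp add: cosh_add sinh_arcosh_real B_pair_ge_1)
  moreover have "0 \<le> ?a + ?b"
    by (simp add: B_pair_ge_1)
  ultimately show ?thesis
    by (metis B_pair_ge_1 arcosh_cosh_real arcosh_less_iff_real cosh_real_ge_1 not_le)
qed

lemma arcosh_B_pair_le_sum:
  fixes x y :: nat
  assumes "x \<le> y"
  shows "arcosh (B_pair \<rho> u s x y) \<le> (\<Sum>i\<in>{x<..y}. arcosh (B_pair \<rho> u s (i - 1) i))"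
  using assms
proof (induction y rule: dec_induct)
  case base
  then show ?case by (simp add: B_pair_def)
next
  case (step y)
  have "{x<..Suc y} = insert (Suc y) {x<..y}" using step by auto
  then show ?case using step arcosh_B_pair_triangle[of \<rho> u s x "Suc y" y] by simp
qed

text \<open>With \<open>d\<close> the hyperbolic distance, this is the chain
  \<open>ln (cosh d) \<le> d\<^sup>2 / 2\<close>, \<open>d \<le> \<Sum> d\<^sub>i\<close>, \<open>(\<Sum> d\<^sub>i)\<^sup>2 \<le> \<Sum> d\<^sub>i\<^sup>2 / p\<^sub>i\<close> and \<open>d\<^sub>i\<^sup>2 / 2 \<le> cosh d\<^sub>i - 1\<close>.\<close>
lemma B_pair_powr_le:
  fixes x y :: nat
  assumes xy: "x \<le> y" and m: "0 \<le> m"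
    and p: "\<And>i. i \<in> {x<..y} \<Longrightarrow> 0 < p i" "(\<Sum>i\<in>{x<..y}. p i) \<le> 1"
  shows "B_pair \<rho> u s x y powr m \<le> exp (\<Sum>i\<in>{x<..y}. m / p i * (B_pair \<rho> u s (i - 1) i - 1))"
proof -
  let ?I = "{x<..y}"
  define d where "d i = arcosh (B_pair \<rho> u s (i - 1) i)" for i
  let ?D = "arcosh (B_pair \<rho> u s x y)"
  have D0: "0 \<le> ?D" by (simp add: B_pair_ge_1)
  have dp: "(d i)\<^sup>2 / p i \<ge> 0" if "i \<in> ?I" for i using p(1)[OF that] by simp
  have "?D\<^sup>2 \<le> (\<Sum>i\<in>?I. d i)\<^sup>2"
    using arcosh_B_pair_le_sum[OF xy, of \<rho> u s] D0 unfolding d_def by (rule power_mono)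
  also have "(\<Sum>i\<in>?I. d i) = (\<Sum>i\<in>?I. sqrt (p i) * (d i / sqrt (p i)))"
    using p(1) by (intro sum.cong refl) force
  also have "\<dots>\<^sup>2 \<le> (\<Sum>i\<in>?I. (sqrt (p i))\<^sup>2) * (\<Sum>i\<in>?I. (d i / sqrt (p i))\<^sup>2)"
    by (rule Cauchy_Schwarz_ineq_sum)
  also have "\<dots> = (\<Sum>i\<in>?I. p i) * (\<Sum>i\<in>?I. (d i)\<^sup>2 / p i)"
    using p(1) by (intro arg_cong2[of _ _ _ _ "(*)"] sum.cong refl) (auto simp: power_divide less_imp_le)
  also have "\<dots> \<le> 1 * (\<Sum>i\<in>?I. (d i)\<^sup>2 / p i)"
    using p(2) dp by (intro mult_right_mono sum_nonneg) auto
  finally have D2: "?D\<^sup>2 \<le> (\<Sum>i\<in>?I. (d i)\<^sup>2 / p i)" by simp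
  have "B_pair \<rho> u s x y = cosh ?D" by (simp add: B_pair_ge_1)
  also have "\<dots> powr m \<le> exp (?D\<^sup>2 / 2) powr m"
    by (intro powr_mono2 m cosh_le_exp_sq) (simp add: cosh_real_nonneg)
  also have "\<dots> = exp (m * (?D\<^sup>2 / 2))" by (simp add: powr_def)
  also have "m * (?D\<^sup>2 / 2) \<le> m * ((\<Sum>i\<in>?I. (d i)\<^sup>2 / p i) / 2)"
    using D2 m by (intro mult_left_mono) auto
  also have "\<dots> = (\<Sum>i\<in>?I. m / p i * ((d i)\<^sup>2 / 2))"
    by (simp add: sum_distrib_left sum_divide_distrib)
  also have "\<dots> \<le> (\<Sum>i\<in>?I. m / p i * (B_pair \<rho> u s (i - 1) i - 1))"
  proof (intro sum_mono mult_left_mono)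
    fix i assume "i \<in> ?I"
    then show "0 \<le> m / p i" using m p(1)[of i] by simp
    show "(d i)\<^sup>2 / 2 \<le> B_pair \<rho> u s (i - 1) i - 1"
      using sq_le_cosh[of "d i"] by (simp add: d_def B_pair_ge_1)
  qed
  finally show ?thesis by simp
qed

text \<open>This rests on \<open>B \<le> exp (B - 1)\<close> alone. For a nearest-neighbor edge it
  avoids the passage to squared distances and leads to the ratio \<open>m / W\<close>
  itself.\<close>

lemma B_pair_powr_le_exp:
  assumes "0 \<le> m"
  shows "B_pair \<rho> u s i j powr m \<le> exp (m * (B_pair \<rho> u s i j - 1))"
proof -
  have "B_pair \<rho> u s i j powr m \<le> exp (B_pair \<rho> u s i j - 1) powr m"
    using assms exp_ge_add_one_self[of "B_pair \<rho> u s i j - 1"] B_pair_ge_1[of \<rho> u s i j]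
    by (intro powr_mono2) auto
  then show ?thesis by (simp add: powr_def)
qed

section \<open>Products of factors close to 1\<close>

lemma prod_one_minus_ge:
  fixes r :: "'a \<Rightarrow> real"
  assumes "finite I" "\<And>i. i \<in> I \<Longrightarrow> 0 \<le> r i \<and> r i \<le> 1"
  shows "1 - (\<Sum>i\<in>I. r i) \<le> (\<Prod>i\<in>I. 1 - r i)"
  using assms
proof (induction I rule: finite_induct)
  case (insert j I)
  have "(\<Prod>i\<in>I. 1 - r i) \<le> 1" using insert.prems by (intro prod_le_1) auto
  then have "r j * (\<Prod>i\<in>I. 1 - r i) \<le> r j" using insert.prems[of j] mult_left_mono[of _ 1 "r j"] by simp
  then show ?case using insert by (simp add: algebra_simps)
qed simp

text \<open>The product of the \<open>1 - r i\<close> is at least one minus the sum of the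
  \<open>r i\<close>, and the threshold is chosen so that
  \<open>1 - \<kappa> / (1 + \<kappa>) = 1 / (1 + \<kappa>)\<close>.\<close>

lemma prod_inverse_one_minus_le:
  fixes r :: "'a \<Rightarrow> real"
  assumes "finite I" "\<And>i. i \<in> I \<Longrightarrow> 0 \<le> r i" "0 < \<kappa>" "(\<Sum>i\<in>I. r i) \<le> \<kappa> / (1 + \<kappa>)"
  shows "(\<Prod>i\<in>I. 1 / (1 - r i)) \<le> 1 + \<kappa>"
proof -
  have lt: "\<kappa> / (1 + \<kappa>) < 1" using assms by simp
  have r1: "r i < 1" if "i \<in> I" for i
  proof -
    have "r i \<le> (\<Sum>i\<in>I. r i)" by (rule member_le_sum) (use assms that in auto)
    then show ?thesis using assms(4) lt by linarith
  qed
  have pos: "0 < (\<Prod>i\<in>I. 1 - r i)" using r1 by (intro prod_pos) auto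
  have "1 / (1 + \<kappa>) = 1 - \<kappa> / (1 + \<kappa>)" using assms by (simp add: field_simps)
  also have "\<dots> \<le> (\<Prod>i\<in>I. 1 - r i)"
    using prod_one_minus_ge[of I r] assms r1 by (force intro: less_imp_le)
  finally have "1 / (\<Prod>i\<in>I. 1 - r i) \<le> 1 + \<kappa>" using assms pos by (simp add: field_simps)
  then show ?thesis by (simp add: prod_dividef)
qed

section \<open>Exponential moments\<close>

text \<open>Connects the sum over ordered pairs, convenient for elimination, with the sum over edges
  in \<open>mu_density\<close>; both grow by the star of a new vertex.\<close>

lemma energy_eq_sum_edges:
  fixes V :: "'a::linorder set"
  assumes "finite V"
  shows "energy \<rho> V W u s = (\<Sum>e\<in>edges V. W e * (B_edge \<rho> u s e - 1))"
  using assms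
proof (induction V rule: finite_induct)
  case empty
  have "edges ({} :: 'a set) = {}" by (auto simp: edges_def)
  then show ?case by (simp add: energy_def)
next
  case (insert n V)
  have ed: "edges (insert n V) = edges V \<union> (\<lambda>j. {n, j}) ` V"
  proof safe
    fix e assume e: "e \<in> edges (insert n V)" "e \<notin> (\<lambda>j. {n, j}) ` V"
    then obtain a b where "e = {a, b}" "a \<noteq> b" "{a, b} \<subseteq> insert n V"
      by (auto simp: edges_def card_2_iff)
    then show "e \<in> edges V" using e by (auto simp: edges_def)
  qed (use insert.hyps in \<open>auto simp: edges_def card_insert_if\<close>)
  have fin: "finite (edges V)"
    using insert.hyps by (intro finite_edges)
  have disj: "edges V \<inter> (\<lambda>j. {n, j}) ` V = {}" using insert.hyps by (auto simp: edges_def)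
  have inj: "inj_on (\<lambda>j. {n, j}) V" by (auto simp: inj_on_def doubleton_eq_iff)
  have "(\<Sum>e\<in>edges (insert n V). W e * (B_edge \<rho> u s e - 1))
      = (\<Sum>e\<in>edges V. W e * (B_edge \<rho> u s e - 1)) + (\<Sum>j\<in>V. W {n, j} * (B_pair \<rho> u s n j - 1))"
    unfolding ed using insert.hyps fin disj inj
    by (simp add: sum.union_disjoint sum.reindex B_edge_doubleton)
  then show ?case using insert by (simp add: energy_insert)
qed

lemma mu_density_eq_pdens:
  assumes "finite \<Lambda>" "\<And>e. e \<in> edges (insert \<rho> \<Lambda>) \<Longrightarrow> 0 \<le> W e"
  shows "mu_density \<Lambda> \<rho> W u s = pdens \<Lambda> \<rho> W u s"
proof -
  let ?E = "edges (insert \<rho> \<Lambda>)"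
  have fin: "finite ?E"
    using assms by (intro finite_edges) simp
  have "(\<Sum>e | e \<in> ?E \<and> W e > 0. W e * (B_edge \<rho> u s e - 1)) = (\<Sum>e\<in>?E. W e * (B_edge \<rho> u s e - 1))"
    using fin assms(2) by (intro sum.mono_neutral_left) (auto simp: order_less_le)
  then show ?thesis using assms(1) by (simp add: mu_density_def pdens_def energy_eq_sum_edges)
qed

lemma edge_endpoints:
  assumes "e \<in> edges (V :: 'a::linorder set)"
  shows "e = {Min e, Max e}" "Min e \<in> V" "Max e \<in> V" "Min e < Max e"
proof -
  from assms obtain a b where ab: "e = {a, b}" "a \<noteq> b" "{a, b} \<subseteq> V"
    by (auto simp: edges_def card_2_iff)
  then show "e = {Min e, Max e}" "Min e \<in> V" "Max e \<in> V" "Min e < Max e"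
    by (cases "a \<le> b"; auto simp: min_def max_def)+
qed

text \<open>In the exponent the extra factor is absorbed exactly by lowering the weights. Only the
  determinant costs something: the ratio of the old and new conductance of \<open>e\<close> is
  \<open>W e / (W e - l e)\<close>, from which \<open>u\<close> has cancelled.\<close>

lemma exp_times_pdens_le:
  fixes \<Lambda> :: "'a::linorder set"
  assumes fin: "finite \<Lambda>" and \<rho>: "\<rho> \<notin> \<Lambda>" and W: "\<And>e. e \<in> edges (insert \<rho> \<Lambda>) \<Longrightarrow> 0 \<le> W e"
    and U: "U \<subseteq> edges (insert \<rho> \<Lambda>)" and lam: "\<And>e. e \<in> U \<Longrightarrow> 0 \<le> l e \<and> l e < W e"
  shows "exp (\<Sum>e\<in>U. l e * (B_edge \<rho> u s e - 1)) * pdens \<Lambda> \<rho> W u s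
       \<le> (\<Prod>e\<in>U. 1 / (1 - l e / W e)) * pdens \<Lambda> \<rho> (\<lambda>e. if e \<in> U then W e - l e else W e) u s"
proof -
  let ?E = "edges (insert \<rho> \<Lambda>)"
  let ?W = "\<lambda>e. if e \<in> U then W e - l e else W e"
  let ?b = "\<lambda>e. B_edge \<rho> u s e - 1"
  have finE: "finite ?E"
    using fin by (intro finite_edges) simp
  have "(\<Sum>e\<in>?E. W e * ?b e) = (\<Sum>e\<in>?E. ?W e * ?b e + (if e \<in> U then l e * ?b e else 0))"
    by (intro sum.cong refl) (simp add: algebra_simps)
  also have "\<dots> = (\<Sum>e\<in>?E. ?W e * ?b e) + (\<Sum>e\<in>U. l e * ?b e)"
    using finE U by (simp add: sum.distrib sum.inter_restrict[symmetric] Int_absorb1)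
  finally have en: "energy \<rho> (insert \<rho> \<Lambda>) W u s = energy \<rho> (insert \<rho> \<Lambda>) ?W u s + (\<Sum>e\<in>U. l e * ?b e)"
    using fin by (simp add: energy_eq_sum_edges)
  have det: "set_det \<Lambda> (D_mat \<Lambda> \<rho> W u) \<le> (\<Prod>e\<in>U. 1 / (1 - l e / W e)) * set_det \<Lambda> (D_mat \<Lambda> \<rho> ?W u)"
  proof -
    let ?c = "conductance \<rho> W u" and ?c' = "conductance \<rho> ?W u"
    have pos: "0 < (\<Prod>i\<in>e. exp (pin \<rho> u i))" for e by (intro prod_pos) simp
    have "set_det \<Lambda> (lap \<Lambda> \<rho> ?c) \<le> (\<Prod>e\<in>U. ?c e / ?c' e) * set_det \<Lambda> (lap \<Lambda> \<rho> ?c')"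
    proof (rule set_det_lap_le_prod[OF fin \<rho> U])
      show "0 \<le> ?c e" if "e \<in> ?E" for e using W[OF that] by (rule conductance_nonneg)
      show "0 < ?c' e \<and> ?c' e \<le> ?c e" if "e \<in> U" for e
        using that lam[OF that] pos[of e] by (simp add: conductance_def mult_right_mono)
    qed (simp add: conductance_def)
    also have "(\<Prod>e\<in>U. ?c e / ?c' e) = (\<Prod>e\<in>U. 1 / (1 - l e / W e))"
    proof (rule prod.cong[OF refl])
      fix e assume e: "e \<in> U"
      then have "0 < W e" using lam[OF e] by linarith
      then show "?c e / ?c' e = 1 / (1 - l e / W e)"
        using e pos[of e] by (simp add: conductance_def divide_simps)
    qed
    finally show ?thesis using \<rho> by (simp add: set_det_D_mat)
  qed
  let ?P = "\<Prod>i\<in>\<Lambda>. exp (- u i) / (2 * pi)"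
  have "exp (\<Sum>e\<in>U. l e * ?b e) * pdens \<Lambda> \<rho> W u s
      = exp (- energy \<rho> (insert \<rho> \<Lambda>) ?W u s) * set_det \<Lambda> (D_mat \<Lambda> \<rho> W u) * ?P"
    unfolding pdens_def en by (simp add: exp_add[symmetric])
  also have "\<dots> \<le> exp (- energy \<rho> (insert \<rho> \<Lambda>) ?W u s)
      * ((\<Prod>e\<in>U. 1 / (1 - l e / W e)) * set_det \<Lambda> (D_mat \<Lambda> \<rho> ?W u)) * ?P"
    using det by (intro mult_right_mono mult_left_mono prod_nonneg) auto
  finally show ?thesis unfolding pdens_def by (simp only: mult_ac)
qed

text \<open>The pointwise bound \<open>exp_times_pdens_le\<close> is integrated. The lowered weights
  are still nonnegative, so their density has mass at most 1.\<close>

lemma expect_exp_le: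
  fixes \<Lambda> :: "'a::linorder set"
  assumes fin: "finite \<Lambda>" and \<rho>: "\<rho> \<notin> \<Lambda>" and W: "\<And>e. e \<in> edges (insert \<rho> \<Lambda>) \<Longrightarrow> 0 \<le> W e"
    and U: "U \<subseteq> edges (insert \<rho> \<Lambda>)" and lam: "\<And>e. e \<in> U \<Longrightarrow> 0 \<le> l e \<and> l e < W e"
  shows "expect \<Lambda> \<rho> W (\<lambda>u s. exp (\<Sum>e\<in>U. l e * (B_edge \<rho> u s e - 1)))
       \<le> ennreal (\<Prod>e\<in>U. 1 / (1 - l e / W e))"
proof -
  let ?M = "lborel_Pi \<Lambda> \<Otimes>\<^sub>M lborel_Pi \<Lambda>"
  let ?W = "\<lambda>e. if e \<in> U then W e - l e else W e"
  let ?f = "\<lambda>u s. exp (\<Sum>e\<in>U. l e * (B_edge \<rho> u s e - 1))"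
  let ?K = "\<Prod>e\<in>U. 1 / (1 - l e / W e)"
  interpret P: sigma_finite_measure "lborel_Pi \<Lambda>" using fin by (rule sigma_finite_lborel_Pi)
  have c1: "(\<lambda>\<omega>. fst \<omega> i) \<in> borel_measurable ?M" and c2: "(\<lambda>\<omega>. snd \<omega> i) \<in> borel_measurable ?M"
    if "i \<in> \<Lambda>" for i
    using that
    by (rule measurable_compose[OF measurable_fst borel_measurable_lborel_Pi_component],
        rule measurable_compose[OF measurable_snd borel_measurable_lborel_Pi_component])
  have mp: "(\<lambda>\<omega>. ennreal (pdens \<Lambda> \<rho> W' (fst \<omega>) (snd \<omega>))) \<in> borel_measurable ?M" for W'
    by (intro measurable_compose[OF borel_measurable_pdens measurable_ennreal] fin c1 c2) auto
  have mB: "(\<lambda>\<omega>. B_edge \<rho> (fst \<omega>) (snd \<omega>) e) \<in> borel_measurable ?M" if "e \<in> U" for e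
    unfolding B_edge_def using edge_endpoints(2,3)[of e "insert \<rho> \<Lambda>"] that U c1 c2
    by (intro borel_measurable_B_pair) auto
  have mf: "(\<lambda>\<omega>. ennreal (?f (fst \<omega>) (snd \<omega>))) \<in> borel_measurable ?M"
  proof -
    have "(\<lambda>\<omega>. \<Sum>e\<in>U. l e * (B_edge \<rho> (fst \<omega>) (snd \<omega>) e - 1)) \<in> borel_measurable ?M"
      using mB by (intro borel_measurable_sum borel_measurable_times borel_measurable_diff) auto
    then show ?thesis by measurable
  qed
  have W'0: "0 \<le> ?W e" if "e \<in> edges (insert \<rho> \<Lambda>)" for e
    using W[OF that] lam[of e] by auto
  have lt: "0 < 1 - l e / W e" if "e \<in> U" for e
    using lam[OF that] by (simp add: divide_less_eq)
  have K0: "0 \<le> ?K" using lt by (intro prod_nonneg) (auto intro: less_imp_le)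
  have "expect \<Lambda> \<rho> W ?f = (\<integral>\<^sup>+\<omega>. ennreal (?f (fst \<omega>) (snd \<omega>))
      \<partial>density ?M (\<lambda>\<omega>. ennreal (pdens \<Lambda> \<rho> W (fst \<omega>) (snd \<omega>))))"
    unfolding expect_def mu_def using mu_density_eq_pdens[OF fin, of \<rho> W] W
    by (simp add: case_prod_beta')
  also have "\<dots> = (\<integral>\<^sup>+\<omega>. ennreal (pdens \<Lambda> \<rho> W (fst \<omega>) (snd \<omega>)) * ennreal (?f (fst \<omega>) (snd \<omega>)) \<partial>?M)"
    by (rule nn_integral_density[OF mp mf])
  also have "\<dots> \<le> (\<integral>\<^sup>+\<omega>. ennreal ?K * ennreal (pdens \<Lambda> \<rho> ?W (fst \<omega>) (snd \<omega>)) \<partial>?M)"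
  proof (rule nn_integral_mono)
    fix \<omega> :: "('a \<Rightarrow> real) \<times> ('a \<Rightarrow> real)"
    have "ennreal (pdens \<Lambda> \<rho> W (fst \<omega>) (snd \<omega>)) * ennreal (?f (fst \<omega>) (snd \<omega>))
        = ennreal (?f (fst \<omega>) (snd \<omega>) * pdens \<Lambda> \<rho> W (fst \<omega>) (snd \<omega>))"
      using pdens_nonneg[OF fin \<rho> W] by (simp add: ennreal_mult mult.commute)
    also have "\<dots> \<le> ennreal (?K * pdens \<Lambda> \<rho> ?W (fst \<omega>) (snd \<omega>))"
      by (intro ennreal_leI exp_times_pdens_le fin \<rho> W U lam)
    also have "\<dots> = ennreal ?K * ennreal (pdens \<Lambda> \<rho> ?W (fst \<omega>) (snd \<omega>))"
      using K0 by (rule ennreal_mult) (rule pdens_nonneg[OF fin \<rho> W'0])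
    finally show "ennreal (pdens \<Lambda> \<rho> W (fst \<omega>) (snd \<omega>)) * ennreal (?f (fst \<omega>) (snd \<omega>))
        \<le> ennreal ?K * ennreal (pdens \<Lambda> \<rho> ?W (fst \<omega>) (snd \<omega>))" .
  qed
  also have "\<dots> = ennreal ?K * (\<integral>\<^sup>+u. \<integral>\<^sup>+s. ennreal (pdens \<Lambda> \<rho> ?W u s) \<partial>lborel_Pi \<Lambda> \<partial>lborel_Pi \<Lambda>)"
    using P.nn_integral_fst[OF mp[of ?W]] by (simp add: nn_integral_cmult[OF mp])
  also have "\<dots> \<le> ennreal ?K * 1"
    by (intro mult_left_mono nn_integral_pdens_le_1 fin \<rho> W'0) auto
  finally show ?thesis by simp
qed

section \<open>The inhomogeneous model\<close>

lemma inhom_model_weights_nonneg: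
  assumes "inhom_model \<alpha> Wbar N \<rho> W" "e \<in> edges (insert \<rho> ({1..N} - {\<rho>}))"
  shows "0 \<le> W e"
proof (cases "e \<in> edges {1..N}")
  case True
  then show ?thesis using assms by (auto simp: inhom_model_def)
next
  case False
  \<comment> \<open>If \<open>\<rho>\<close> were in \<open>{1..N}\<close>, the edge would lie in
    \<open>{1..N}\<close>. So the pinning is of type P1, and the weight of the edge is a pinning
    strength.\<close>
  then have "\<not> pinning_P2 N \<rho>"
    using assms(2) by (auto simp: pinning_P2_def edges_def subset_iff)
  then have P1: "pinning_P1 N \<rho> W" using assms by (auto simp: inhom_model_def)
  have "\<rho> \<in> e" using False assms(2) by (auto simp: edges_def)
  moreover obtain a b where "e = {a, b}" "a \<noteq> b" "{a, b} \<subseteq> insert \<rho> ({1..N} - {\<rho>})"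
    using assms(2) by (auto simp: edges_def card_2_iff)
  ultimately obtain j where "e = {j, \<rho>}" "j \<in> {1..N}" by (auto simp: insert_commute)
  then show ?thesis using P1 by (auto simp: pinning_P1_def)
qed

lemma inhom_expect_mono:
  assumes "\<And>u s. f u s \<le> g u s"
  shows "inhom_expect N \<rho> W f \<le> inhom_expect N \<rho> W g"
  unfolding inhom_expect_def expect_def using assms
  by (intro nn_integral_mono) (auto intro: ennreal_leI)

text \<open>Disjointness of the intervals makes the real point \<open>i - 1 / 2\<close> lie in at most one of them.\<close>
lemma inhom_expect_prod_le:
  fixes F :: "nat set set" and m :: "nat set \<Rightarrow> real" and l :: "nat set \<Rightarrow> nat \<Rightarrow> real"
  assumes model: "inhom_model \<alpha> Wbar N \<rho> W" and F: "F \<subseteq> edges {1..N}"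
    and disj: "\<And>e e'. e \<in> F \<Longrightarrow> e' \<in> F \<Longrightarrow> e \<noteq> e' \<Longrightarrow> edge_interval e \<inter> edge_interval e' = {}"
    and bound: "\<And>e u s. e \<in> F \<Longrightarrow> B_edge \<rho> u s e powr m e
        \<le> exp (\<Sum>i\<in>{Min e<..Max e}. l e i * (B_pair \<rho> u s (i - 1) i - 1))"
    and l: "\<And>e i. e \<in> F \<Longrightarrow> i \<in> {Min e<..Max e} \<Longrightarrow> 0 \<le> l e i \<and> l e i < W {i - 1, i}"
  shows "inhom_expect N \<rho> W (\<lambda>u s. \<Prod>e\<in>F. B_edge \<rho> u s e powr m e)
       \<le> ennreal (\<Prod>e\<in>F. \<Prod>i\<in>{Min e<..Max e}. 1 / (1 - l e i / W {i - 1, i}))"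
proof -
  let ?I = "\<lambda>e. {Min e<..Max e}" and ?V = "insert \<rho> ({1..N} - {\<rho>})"
  have finF: "finite F"
    using F by (rule finite_subset) (simp add: finite_edges)
  have unique: "e = e'" if "e \<in> F" "e' \<in> F" "i \<in> ?I e" "i \<in> ?I e'" for e e' and i :: nat
  proof (rule ccontr)
    assume "e \<noteq> e'"
    moreover have "real i - 1 / 2 \<in> edge_interval e" "real i - 1 / 2 \<in> edge_interval e'"
      using that by (auto simp: edge_interval_def)
    ultimately show False using disj that by blast
  qed
  \<comment> \<open>A nearest-neighbor edge \<open>{i - 1, i}\<close> is indexed by its right
    endpoint. As \<open>i > Min e \<ge> 1\<close>, the truncated subtraction is exact and the edge
    lies in \<open>{1..N}\<close>.\<close>
  define T where "T = (\<Union>e\<in>F. ?I e)"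
  have T: "i \<in> {2..N}" if i: "i \<in> T" for i
  proof -
    obtain e where "e \<in> F" "i \<in> ?I e" using i by (auto simp: T_def)
    then show ?thesis using edge_endpoints(2,3)[of e "{1..N}"] F by force
  qed
  define U where "U = (\<lambda>i. {i - 1, i}) ` T"
  have Max_pred: "Max {i - 1, i} = i" for i :: nat by (simp add: max_def)
  have inj: "inj_on (\<lambda>i. {i - 1, i}) T" by (rule inj_on_inverseI[of _ Max]) (rule Max_pred)
  have U: "U \<subseteq> edges ?V"
  proof
    fix e assume "e \<in> U"
    then obtain i where i: "i \<in> T" "e = {i - 1, i}" by (auto simp: U_def)
    then show "e \<in> edges ?V" using T[of i] by (auto intro!: doubleton_edges)
  qed
  \<comment> \<open>\<open>Max e0\<close> recovers the index \<open>i\<close> of the edge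
    \<open>{i - 1, i}\<close>. On \<open>U\<close> the sum has a single term, that of the only
    \<open>e\<close> in \<open>F\<close> whose interval covers \<open>i\<close>.\<close>
  define lam where "lam e0 = (\<Sum>e | e \<in> F \<and> Max e0 \<in> ?I e. l e (Max e0))" for e0
  have lam: "lam {i - 1, i} = l e i" if "e \<in> F" "i \<in> ?I e" for e i
  proof -
    have "{e' \<in> F. i \<in> ?I e'} = {e}" using that unique by blast
    then show ?thesis by (simp add: lam_def Max_pred del: greaterThanAtMost_iff)
  qed
  have sumU: "(\<Sum>e\<in>U. g e) = (\<Sum>e\<in>F. \<Sum>i\<in>?I e. g {i - 1, i})" for g :: "nat set \<Rightarrow> real"
  proof -
    have "(\<Sum>e\<in>U. g e) = (\<Sum>i\<in>T. g {i - 1, i})"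
      unfolding U_def sum.reindex[OF inj] comp_def ..
    also have "\<dots> = (\<Sum>e\<in>F. \<Sum>i\<in>?I e. g {i - 1, i})"
      unfolding T_def using unique by (intro sum.UNION_disjoint finF ballI impI) blast+
    finally show ?thesis .
  qed
  have prodU: "(\<Prod>e\<in>U. g e) = (\<Prod>e\<in>F. \<Prod>i\<in>?I e. g {i - 1, i})" for g :: "nat set \<Rightarrow> real"
  proof -
    have "(\<Prod>e\<in>U. g e) = (\<Prod>i\<in>T. g {i - 1, i})"
      unfolding U_def prod.reindex[OF inj] comp_def ..
    also have "\<dots> = (\<Prod>e\<in>F. \<Prod>i\<in>?I e. g {i - 1, i})"
      unfolding T_def using unique by (intro prod.UNION_disjoint finF ballI impI) blast+
    finally show ?thesis .
  qed
  have "(\<Prod>e\<in>F. B_edge \<rho> u s e powr m e) \<le> exp (\<Sum>e\<in>U. lam e * (B_edge \<rho> u s e - 1))" for u s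
  proof -
    have "(\<Prod>e\<in>F. B_edge \<rho> u s e powr m e)
        \<le> (\<Prod>e\<in>F. exp (\<Sum>i\<in>?I e. l e i * (B_pair \<rho> u s (i - 1) i - 1)))"
      using bound by (intro prod_mono) auto
    also have "\<dots> = exp (\<Sum>e\<in>F. \<Sum>i\<in>?I e. l e i * (B_pair \<rho> u s (i - 1) i - 1))"
      using finF by (simp add: exp_sum)
    also have "\<dots> = exp (\<Sum>e\<in>U. lam e * (B_edge \<rho> u s e - 1))"
      unfolding sumU by (intro arg_cong[of _ _ exp] sum.cong refl) (simp only: lam B_edge_doubleton)
    finally show ?thesis .
  qed
  then have "inhom_expect N \<rho> W (\<lambda>u s. \<Prod>e\<in>F. B_edge \<rho> u s e powr m e)
      \<le> inhom_expect N \<rho> W (\<lambda>u s. exp (\<Sum>e\<in>U. lam e * (B_edge \<rho> u s e - 1)))"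
    by (rule inhom_expect_mono)
  also have "\<dots> \<le> ennreal (\<Prod>e\<in>U. 1 / (1 - lam e / W e))"
    unfolding inhom_expect_def
  proof (rule expect_exp_le)
    show "0 \<le> lam e \<and> lam e < W e" if "e \<in> U" for e
    proof -
      from that obtain i e' where i: "e = {i - 1, i}" "e' \<in> F" "i \<in> ?I e'"
        by (auto simp: U_def T_def)
      show ?thesis using l[OF i(2,3)] by (simp only: i(1) lam[OF i(2,3)])
    qed
  qed (use inhom_model_weights_nonneg[OF model] U in auto)
  also have "(\<Prod>e\<in>U. 1 / (1 - lam e / W e)) = (\<Prod>e\<in>F. \<Prod>i\<in>?I e. 1 / (1 - l e i / W {i - 1, i}))"
    unfolding prodU by (intro prod.cong refl) (simp only: lam)
  finally show ?thesis .
qed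

section \<open>Choice of the constants and the moment bounds\<close>

theorem theorem1p3:
  fixes \<kappa> \<alpha> \<gamma> :: real
  assumes "0 < \<kappa>" and "\<kappa> \<le> 1" and "\<alpha> > 3" and "\<gamma> \<ge> 0" and "\<alpha> - \<gamma> > 3"
  shows "\<exists>Wbar0 c3 :: real. Wbar0 > 0 \<and> c3 > 0 \<and>
    (\<forall>Wbar\<ge>Wbar0. \<forall>(N::nat) (\<rho>::nat) (W :: nat set \<Rightarrow> real).
      inhom_model \<alpha> Wbar N \<rho> W \<longrightarrow>
      (\<forall>(E' :: nat set set) (E'' :: nat set set) (m :: nat set \<Rightarrow> real).
          E' \<subseteq> edges {1..N} \<longrightarrow> E'' \<subseteq> edges {1..N} \<longrightarrow> E' \<inter> E'' = {} \<longrightarrow>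
          (\<forall>e\<in>E'. Max e - Min e = 1) \<longrightarrow>
          (\<forall>e\<in>E' \<union> E''. \<forall>e2\<in>E' \<union> E''. e \<noteq> e2 \<longrightarrow> edge_interval e \<inter> edge_interval e2 = {}) \<longrightarrow>
          (\<forall>e\<in>E'. 0 \<le> m e \<and> m e < W e) \<longrightarrow>
          (\<forall>e\<in>E''. 0 \<le> m e \<and> m e \<le> max_exponent \<gamma> c3 Wbar (Min e)) \<longrightarrow>
          inhom_expect N \<rho> W
            (\<lambda>u s. (\<Prod>e\<in>E'. B_edge \<rho> u s e powr m e) * (\<Prod>e\<in>E''. B_edge \<rho> u s e powr m e))
            \<le> ennreal ((\<Prod>e\<in>E'. 1 / (1 - m e / W e)) * (1 + \<kappa>) ^ card E'')
          \<and> ((\<forall>e\<in>E'. m e \<le> max_exponent \<gamma> c3 Wbar (Min e) \<or> m e \<le> \<kappa> / (1 + \<kappa>) * W e) \<longrightarrow>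
              (\<Prod>e\<in>E'. 1 / (1 - m e / W e)) * (1 + \<kappa>) ^ card E''
              \<le> (1 + \<kappa>) ^ (card E' + card E'')))
      \<and> (\<forall>x\<in>{1..N}. \<forall>y\<in>{1..N}. x < y \<longrightarrow>
          (\<forall>m::real. 0 \<le> m \<longrightarrow> m \<le> max_exponent \<gamma> c3 Wbar x \<longrightarrow>
            inhom_expect N \<rho> W (\<lambda>u s. cosh (pin \<rho> u x - pin \<rho> u y) powr m)
              \<le> inhom_expect N \<rho> W (\<lambda>u s. B_edge \<rho> u s {x, y} powr m)
            \<and> inhom_expect N \<rho> W (\<lambda>u s. B_edge \<rho> u s {x, y} powr m) \<le> ennreal (1 + \<kappa>))))"
proof -
  \<comment> \<open>The exponent \<open>3 / 2\<close> splits the available power 3 evenly: dividing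
    by \<open>q i\<close> costs \<open>3 / 2\<close> powers of \<open>i\<close>, and keeping a
    summable factor \<open>q i\<close> in the ratio costs another \<open>3 / 2\<close>, which
    \<open>\<alpha> - \<gamma> > 3\<close> pays for.\<close>
  define q where "q i = real i powr (- (3 / 2))" for i :: nat
  define Z where "Z = (\<Sum>i. q i)"
  have q_summable: "summable q"
    unfolding q_def using summable_real_powr_iff[of "- (3 / 2)"] by simp
  have q0: "0 \<le> q i" for i by (simp add: q_def)
  have q_le: "(\<Sum>i\<in>I. q i) \<le> Z" if "finite I" for I
    unfolding Z_def using q_summable that q0 by (intro sum_le_suminf) auto
  have Z1: "1 \<le> Z" using q_le[of "{1}"] by (simp add: q_def)
  \<comment> \<open>This makes \<open>c3 * Z * Z\<close>, the bound on the sum of the ratios along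
    an edge, equal to the threshold in \<open>prod_inverse_one_minus_le\<close>.\<close>
  define c3 where "c3 = \<kappa> / (1 + \<kappa>) / Z\<^sup>2"
  have c3: "0 < c3" using assms Z1 by (simp add: c3_def)
  have c3Z: "c3 * Z * Z = \<kappa> / (1 + \<kappa>)" using Z1 by (simp add: c3_def power2_eq_square)
  have c3_le: "c3 \<le> \<kappa> / (1 + \<kappa>)"
  proof -
    have "1 * 1 \<le> Z * Z" using Z1 by (intro mult_mono) auto
    then have "c3 * 1 \<le> c3 * (Z * Z)" using c3 by (intro mult_left_mono) auto
    then show ?thesis using c3Z by (simp add: mult.assoc)
  qed
  \<comment> \<open>The ratio \<open>\<lambda>\<^sub>i / W\<^sub>i\<close> for the Cauchy-Schwarz
    weights \<open>q i / Z\<close>, with \<open>w\<close> in the role of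
    \<open>W {i - 1, i}\<close>. \<open>Wbar\<close> cancels, and \<open>x < i\<close> allows
    replacing \<open>x\<close> by \<open>i\<close>.\<close>
  have ratio: "max_exponent \<gamma> c3 Wbar x * (Z / q i) / w \<le> c3 * Z * q i"
    if "Wbar > 0" "x < i" "Wbar * real i powr \<alpha> \<le> w" for Wbar w :: real and x i :: nat
  proof -
    have i1: "1 \<le> real i" using that by simp
    have "real x powr \<gamma> / q i \<le> real i powr \<gamma> / q i"
      using that assms q0 by (intro divide_right_mono powr_mono2) auto
    also have "\<dots> = real i powr (\<gamma> + 3 / 2)"
      by (simp add: q_def flip: powr_diff)
    also have "\<dots> \<le> real i powr (\<alpha> + - (3 / 2))"
      using i1 assms by (intro powr_mono) auto
    also have "\<dots> = real i powr \<alpha> * q i" unfolding q_def by (rule powr_add)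
    finally have "real x powr \<gamma> / q i \<le> real i powr \<alpha> * q i" .
    then have "c3 * Z * Wbar * (real x powr \<gamma> / q i) \<le> c3 * Z * Wbar * (real i powr \<alpha> * q i)"
      using c3 Z1 that by (intro mult_left_mono) auto
    also have "\<dots> = c3 * Z * q i * (Wbar * real i powr \<alpha>)" by simp
    also have "\<dots> \<le> c3 * Z * q i * w"
      using c3 Z1 that q0 by (intro mult_left_mono) auto
    finally have le: "c3 * Z * Wbar * (real x powr \<gamma> / q i) \<le> c3 * Z * q i * w" .
    have "0 < Wbar * real i powr \<alpha>" using that by simp
    then have "0 < w" using that by linarith
    moreover have "max_exponent \<gamma> c3 Wbar x * (Z / q i) = c3 * Z * Wbar * (real x powr \<gamma> / q i)"
      by (simp add: max_exponent_def)
    ultimately show ?thesis using le by (simp only: pos_divide_le_eq)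
  qed
  have first_bound:
    "inhom_expect N \<rho> W (\<lambda>u s. (\<Prod>e\<in>E'. B_edge \<rho> u s e powr m e) * (\<Prod>e\<in>E''. B_edge \<rho> u s e powr m e))
        \<le> ennreal ((\<Prod>e\<in>E'. 1 / (1 - m e / W e)) * (1 + \<kappa>) ^ card E'')"
    if Wbar: "1 \<le> Wbar" and model: "inhom_model \<alpha> Wbar N \<rho> W"
      and E': "E' \<subseteq> edges {1..N}" and E'': "E'' \<subseteq> edges {1..N}" and disj: "E' \<inter> E'' = {}"
      and nn: "\<forall>e\<in>E'. Max e - Min e = 1"
      and intervals: "\<forall>e\<in>E' \<union> E''. \<forall>e2\<in>E' \<union> E''. e \<noteq> e2 \<longrightarrow> edge_interval e \<inter> edge_interval e2 = {}"
      and m': "\<forall>e\<in>E'. 0 \<le> m e \<and> m e < W e"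
      and m'': "\<forall>e\<in>E''. 0 \<le> m e \<and> m e \<le> max_exponent \<gamma> c3 Wbar (Min e)"
    for Wbar N \<rho> W E' E'' m
  proof -
    have fin: "finite E'" "finite E''"
      using E' E'' by (auto intro: finite_subset finite_edges)
    let ?I = "\<lambda>e::nat set. {Min e<..Max e}"
    \<comment> \<open>An edge in \<open>E'\<close> keeps its exponent, by
      \<open>B_pair_powr_le_exp\<close>. An edge in \<open>E''\<close> is treated by
      \<open>B_pair_powr_le\<close> with \<open>p i = q i / Z\<close>.\<close>
    define l where "l e i = (if e \<in> E' then m e else m e * (Z / q i))" for e i
    have E'_I: "?I e = {Max e}" "{Max e - 1, Max e} = e" if "e \<in> E'" for e
    proof -
      have "Max e = Suc (Min e)" using nn that by fastforce
      then show "?I e = {Max e}" "{Max e - 1, Max e} = e"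
        using edge_endpoints(1)[of e "{1..N}"] that E' by auto
    qed
    have E''_r: "l e i / W {i - 1, i} \<le> c3 * Z * q i" "0 \<le> l e i" "0 < W {i - 1, i}"
      if e: "e \<in> E''" and i: "i \<in> ?I e" for e i
    proof -
      have "1 \<le> Min e" "Max e \<le> N" using edge_endpoints(2,3)[of e "{1..N}"] e E'' by auto
      then have "i \<in> {2..N}" using i by auto
      then have w: "Wbar * real i powr \<alpha> \<le> W {i - 1, i}" using model by (auto simp: inhom_model_def)
      have "0 < Wbar * real i powr \<alpha>" using Wbar i by simp
      then show W0: "0 < W {i - 1, i}" using w by linarith
      have l: "l e i = m e * (Z / q i)" using e disj by (auto simp: l_def)
      then show "0 \<le> l e i" using m'' e Z1 q0 by simp
      have "l e i / W {i - 1, i} \<le> max_exponent \<gamma> c3 Wbar (Min e) * (Z / q i) / W {i - 1, i}"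
        unfolding l using m'' e Z1 q0 W0 by (intro divide_right_mono mult_right_mono) auto
      also have "\<dots> \<le> c3 * Z * q i"
        using Wbar i w by (intro ratio) auto
      finally show "l e i / W {i - 1, i} \<le> c3 * Z * q i" .
    qed
    have sum_r: "(\<Sum>i\<in>?I e. l e i / W {i - 1, i}) \<le> \<kappa> / (1 + \<kappa>)" if "e \<in> E''" for e
    proof -
      have "(\<Sum>i\<in>?I e. l e i / W {i - 1, i}) \<le> (\<Sum>i\<in>?I e. c3 * Z * q i)"
        using E''_r(1)[OF that] by (rule sum_mono)
      also have "\<dots> \<le> c3 * Z * Z"
        unfolding sum_distrib_left[symmetric] using c3 Z1 q_le by (intro mult_left_mono) auto
      finally show ?thesis unfolding c3Z .
    qed
    have r0: "0 \<le> l e i / W {i - 1, i}" if "e \<in> E''" "i \<in> ?I e" for e i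
      using E''_r(2,3)[OF that] by simp
    have "inhom_expect N \<rho> W (\<lambda>u s. \<Prod>e\<in>E' \<union> E''. B_edge \<rho> u s e powr m e)
        \<le> ennreal (\<Prod>e\<in>E' \<union> E''. \<Prod>i\<in>?I e. 1 / (1 - l e i / W {i - 1, i}))"
    proof (rule inhom_expect_prod_le[OF model])
      fix e u s assume e: "e \<in> E' \<union> E''"
      show "B_edge \<rho> u s e powr m e \<le> exp (\<Sum>i\<in>?I e. l e i * (B_pair \<rho> u s (i - 1) i - 1))"
      proof (cases "e \<in> E'")
        case True
        have "B_edge \<rho> u s e = B_pair \<rho> u s (Max e - 1) (Max e)"
          using B_edge_doubleton[of \<rho> u s "Max e - 1" "Max e"] E'_I(2)[OF True] by simp
        then show ?thesis
          unfolding E'_I(1)[OF True] using True m' B_pair_powr_le_exp[of "m e" \<rho> u s "Max e - 1" "Max e"]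
          by (simp add: l_def)
      next
        case False
        then have e'': "e \<in> E''" using e by simp
        have "Min e < Max e" using edge_endpoints(4)[of e "{1..N}"] e'' E'' by auto
        then have "B_pair \<rho> u s (Min e) (Max e) powr m e
            \<le> exp (\<Sum>i\<in>?I e. m e / (q i / Z) * (B_pair \<rho> u s (i - 1) i - 1))"
        proof (intro B_pair_powr_le)
          show "0 < q i / Z" if "i \<in> ?I e" for i using that Z1 by (simp add: q_def)
          show "(\<Sum>i\<in>?I e. q i / Z) \<le> 1"
            using q_le[of "?I e"] Z1 by (simp add: sum_divide_distrib[symmetric])
        qed (use m'' e'' in auto)
        then show ?thesis using False by (simp add: B_edge_def l_def)
      qed
    next
      fix e i assume e: "e \<in> E' \<union> E''" and i: "i \<in> ?I e"
      show "0 \<le> l e i \<and> l e i < W {i - 1, i}"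
      proof (cases "e \<in> E'")
        case True
        then show ?thesis using i m' E'_I[OF True] by (auto simp: l_def)
      next
        case False
        then have e'': "e \<in> E''" using e by simp
        have "l e i / W {i - 1, i} \<le> (\<Sum>i\<in>?I e. l e i / W {i - 1, i})"
          using i r0[OF e''] by (intro member_le_sum) auto
        also have "\<dots> \<le> \<kappa> / (1 + \<kappa>)" by (rule sum_r[OF e''])
        also have "\<dots> < 1" using assms by simp
        finally show ?thesis using E''_r(2,3)[OF e'' i] by (simp add: divide_less_eq)
      qed
    qed (use E' E'' intervals in auto)
    also have "(\<Prod>e\<in>E' \<union> E''. \<Prod>i\<in>?I e. 1 / (1 - l e i / W {i - 1, i}))
        = (\<Prod>e\<in>E'. 1 / (1 - m e / W e)) * (\<Prod>e\<in>E''. \<Prod>i\<in>?I e. 1 / (1 - l e i / W {i - 1, i}))"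
      unfolding prod.union_disjoint[OF fin disj]
    proof (intro arg_cong2[of _ _ _ _ "(*)"] prod.cong refl)
      fix e assume e: "e \<in> E'"
      show "(\<Prod>i\<in>?I e. 1 / (1 - l e i / W {i - 1, i})) = 1 / (1 - m e / W e)"
        using e E'_I(2)[OF e] by (simp add: E'_I(1)[OF e] l_def)
    qed
    also have "ennreal \<dots> \<le> ennreal ((\<Prod>e\<in>E'. 1 / (1 - m e / W e)) * (\<Prod>e\<in>E''. 1 + \<kappa>))"
    proof (intro ennreal_leI mult_left_mono)
      show "(\<Prod>e\<in>E''. \<Prod>i\<in>?I e. 1 / (1 - l e i / W {i - 1, i})) \<le> (\<Prod>e\<in>E''. 1 + \<kappa>)"
      proof (intro prod_mono conjI)
        fix e assume e: "e \<in> E''"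
        show "(\<Prod>i\<in>?I e. 1 / (1 - l e i / W {i - 1, i})) \<le> 1 + \<kappa>"
          using r0[OF e] sum_r[OF e] assms by (intro prod_inverse_one_minus_le) auto
        show "0 \<le> (\<Prod>i\<in>?I e. 1 / (1 - l e i / W {i - 1, i}))"
        proof (rule prod_nonneg)
          fix i assume i: "i \<in> ?I e"
          have "l e i / W {i - 1, i} \<le> (\<Sum>i\<in>?I e. l e i / W {i - 1, i})"
            using i r0[OF e] by (intro member_le_sum) auto
          also have "\<dots> \<le> \<kappa> / (1 + \<kappa>)" by (rule sum_r[OF e])
          also have "\<dots> < 1" using assms by simp
          finally show "0 \<le> 1 / (1 - l e i / W {i - 1, i})" by simp
        qed
      qed
      show "0 \<le> (\<Prod>e\<in>E'. 1 / (1 - m e / W e))"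
      proof (rule prod_nonneg)
        fix e assume "e \<in> E'"
        then have "0 \<le> m e" "m e < W e" using m' by auto
        then show "0 \<le> 1 / (1 - m e / W e)" by (simp add: divide_le_eq)
      qed
    qed
    finally show ?thesis by (simp add: prod.union_disjoint[OF fin disj])
  qed
  have second_bound:
    "(\<Prod>e\<in>E'. 1 / (1 - m e / W e)) * (1 + \<kappa>) ^ card E'' \<le> (1 + \<kappa>) ^ (card E' + card E'')"
    if Wbar: "1 \<le> Wbar" and model: "inhom_model \<alpha> Wbar N \<rho> W"
      and E': "E' \<subseteq> edges {1..N}"
      and nn: "\<forall>e\<in>E'. Max e - Min e = 1"
      and m': "\<forall>e\<in>E'. 0 \<le> m e \<and> m e < W e"
      and le: "\<forall>e\<in>E'. m e \<le> max_exponent \<gamma> c3 Wbar (Min e) \<or> m e \<le> \<kappa> / (1 + \<kappa>) * W e"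
    for Wbar N \<rho> W m and E' E'' :: "nat set set"
  proof -
    have "(\<Prod>e\<in>E'. 1 / (1 - m e / W e)) \<le> (\<Prod>e\<in>E'. 1 + \<kappa>)"
    proof (intro prod_mono conjI)
      fix e assume e: "e \<in> E'"
      have W0: "0 < W e" using m' e by force
      \<comment> \<open>The first alternative implies the second, because
        \<open>c3 \<le> \<kappa> / (1 + \<kappa>)\<close> and, by \<open>Min e < Max e\<close> and
        \<open>\<gamma> < \<alpha>\<close>, the power of \<open>Min e\<close> in the exponent is at
        most the power of \<open>Max e\<close> in the weight.\<close>
      have "m e \<le> \<kappa> / (1 + \<kappa>) * W e"
      proof (cases "m e \<le> max_exponent \<gamma> c3 Wbar (Min e)")
        case True
        note end_e = edge_endpoints[of e "{1..N}"]
        have Max_e: "Max e = Suc (Min e)" using nn e by fastforce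
        have bounds: "1 \<le> Min e" "Max e \<in> {2..N}" "{Max e - 1, Max e} = e"
          using end_e e E' Max_e by auto
        have "m e \<le> c3 * (Wbar * real (Min e) powr \<gamma>)" using True by (simp add: max_exponent_def)
        also have "\<dots> \<le> \<kappa> / (1 + \<kappa>) * (Wbar * real (Max e) powr \<alpha>)"
        proof (intro mult_mono c3_le)
          have "real (Min e) powr \<gamma> \<le> real (Max e) powr \<gamma>"
            using Max_e assms by (intro powr_mono2) auto
          also have "\<dots> \<le> real (Max e) powr \<alpha>" using Max_e assms by (intro powr_mono) auto
          finally show "real (Min e) powr \<gamma> \<le> real (Max e) powr \<alpha>" .
        qed (use Wbar assms in auto)
        also have "\<dots> \<le> \<kappa> / (1 + \<kappa>) * W e"
        proof (intro mult_left_mono)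
          have "Wbar * real (Max e) powr \<alpha> \<le> W {Max e - 1, Max e}"
            using model bounds(2) by (auto simp: inhom_model_def)
          then show "Wbar * real (Max e) powr \<alpha> \<le> W e" using bounds(3) by simp
        qed (use assms in simp)
        finally show ?thesis .
      qed (use le e in auto)
      then have "m e / W e \<le> \<kappa> / (1 + \<kappa>)" using W0 by (simp add: divide_le_eq)
      moreover have "0 \<le> m e / W e" using m' e W0 by simp
      ultimately show "1 / (1 - m e / W e) \<le> 1 + \<kappa>"
        using prod_inverse_one_minus_le[of "{e}" "\<lambda>e. m e / W e" \<kappa>] assms by simp
      show "0 \<le> 1 / (1 - m e / W e)" using m' e W0 by (auto simp: divide_le_eq less_imp_le)
    qed
    then have "(\<Prod>e\<in>E'. 1 / (1 - m e / W e)) \<le> (1 + \<kappa>) ^ card E'" by simp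
    then show ?thesis
      unfolding power_add using assms by (intro mult_right_mono) auto
  qed
  have edge_bound: "inhom_expect N \<rho> W (\<lambda>u s. B_edge \<rho> u s {x, y} powr m) \<le> ennreal (1 + \<kappa>)"
    if "1 \<le> Wbar" "inhom_model \<alpha> Wbar N \<rho> W" "x \<in> {1..N}" "y \<in> {1..N}" "x < y"
      "0 \<le> m" "m \<le> max_exponent \<gamma> c3 Wbar x" for Wbar m :: real and N \<rho> W x y
  proof -
    have "Min {x, y} = x" using \<open>x < y\<close> by simp
    then show ?thesis
      using first_bound[of Wbar N \<rho> W "{}" "{{x, y}}" "\<lambda>_. m"] that by (simp add: edges_def)
  qed
  have cosh_bound: "inhom_expect N \<rho> W (\<lambda>u s. cosh (pin \<rho> u x - pin \<rho> u y) powr m)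
      \<le> inhom_expect N \<rho> W (\<lambda>u s. B_edge \<rho> u s {x, y} powr m)" if "0 \<le> m" for N \<rho> W x y and m :: real
    using that
    by (intro inhom_expect_mono powr_mono2) (auto simp: B_edge_doubleton B_pair_def cosh_real_nonneg)
  \<comment> \<open>\<open>Wbar0 = 1\<close> serves: \<open>max_exponent\<close> and the lower
    bounds on the weights are both linear in \<open>Wbar\<close>, so the bounds on the ratios do not
    depend on it.\<close>
  show ?thesis
    by (rule exI[of _ 1], rule exI[of _ c3], intro conjI allI impI ballI)
       (use c3 in \<open>simp_all add: first_bound second_bound edge_bound cosh_bound\<close>)
qed

end
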